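(* For any $\phi\in(\mathbb C[\mathcal P_2/\mathfrak S_2])^*$, there exists a sequence of random matrices $(M_N)_{N\in\mathbb N}$ ($M_N$ of size $N$) such that $M_N$ converges in $\mathcal P$-distribution toward a $\mathcal P$-Gaussian whose $\mathcal R$-transform is given by $e^{\boxplus\phi}$.
   Context: Partitions. For $k\ge 0$, $\mathcal P_k$ is the set of partitions of $\{1,\dots,k,1',\dots,k'\}$ ($\mathcal P_0=\{\emptyset\}$), drawn with a top row $1,\dots,k$ and bottom row $1',\dots,k'$. $\mathrm{nc}(p)$ is the number of blocks; $p\vee p'$ the finest partition coarser than both; $\mathrm{id}_k=\{\{i,i'\}\}$; ${}^tp$ exchanges $i$ and $i'$ for every $i$. $d(p,p')=\frac{\mathrm{nc}(p)+\mathrm{nc}(p')}{2}-\mathrm{nc}(p\vee p')$; $p\le p'$ iff $d(\mathrm{id}_k,p)+d(p,p')=d(\mathrm{id}_k,p')$ (a partial order). $\mathfrak S_k$ acts on $\mathcal P_k$ by applying a permutation simultaneously to $1,\dots,k$ and to $1',\dots,k'$. For $I\subset\{1,\dots,k\}$, $p_I$ is the partition formed by the non-empty intersections of the blocks of $p$ with $I\cup I'$, relabelled increasingly. For linear forms $\phi_1,\phi_2\in(\bigoplus_{k\ge0}\mathbb C[\mathcal P_k/\mathfrak S_k])^*$, $(\phi_1\boxplus\phi_2)(p)=\sum\phi_1(p_I)\phi_2(p_{I^c})$, sum over $I\subset\{1,\dots,k\}$ with $\mathrm{nc}(p_I)+\mathrm{nc}(p_{I^c})=\mathrm{nc}(p)$;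 the unit is $p\mapsto\delta_{p=\emptyset}$; $e^{\boxplus\phi}=\sum_{n\ge0}\phi^{\boxplus n}/n!$. A form on $\mathbb C[\mathcal P_2/\mathfrak S_2]$ is extended by $0$ on $\mathcal P_k$, $k\ne2$. A (centered) $\mathcal P$-Gaussian is an element whose $\mathcal R$-transform is $e^{\boxplus\psi}$ where $\psi$ is the restriction of its $\mathcal R$-transform to $\mathcal P_2$ (extended by $0$). Matrices. $\rho_N(p)$ is the sum of $E_{i_{1'}}^{i_1}\otimes\dots\otimes E_{i_{k'}}^{i_k}$ over $(i_1,\dots,i_k,i_{1'},\dots,i_{k'})\in\{1,\dots,N\}^{2k}$ with $i_a=i_b$ whenever $a,b$ are in the same block of $p$ ($E_i^j$ sends $e_j$ to $e_i$, other basis vectors to $0$). Random matrices are complex, with entries having finite moments of all orders. For $p\in\mathcal P_k$, $\mathbb Em_p(M)=N^{-\mathrm{nc}(p\vee\mathrm{id}_k)}\mathbb E\,\mathrm{Tr}[M^{\otimes k}\rho_N({}^tp)]$. $M_N$ converges in $\mathcal P$-distribution if $\mathbb Em_p(M_N)$ converges for every $k$ and $p\in\mathcal P_k$; the limit has $\mathcal R$-transform $\psi$ if $\lim_N\mathbb Em_p(M_N)=\sum_{p'\in\mathcal P_k,\,p'\le p}\psi(p')$ for all $k$ and $p\in\mathcal P_k$. *)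

theory Defs
  imports "HOL-Probability.Probability"
begin

text \<open>The point \<open>i\<close> of the top row is \<open>Inl i\<close>, the point \<open>i'\<close> of the bottom row is \<open>Inr i\<close>.\<close>

type_synonym diagram = "(nat + nat) set set"

definition points :: "nat \<Rightarrow> (nat + nat) set" where
  "points k = {1..k} <+> {1..k}"

definition Part :: "nat \<Rightarrow> diagram set" where
  "Part k = {p. partition_on (points k) p}"

definition nc :: "diagram \<Rightarrow> nat" where
  "nc p = card p"

definition is_pjoin :: "nat \<Rightarrow> diagram \<Rightarrow> diagram \<Rightarrow> diagram \<Rightarrow> bool" where
  "is_pjoin k p p' q \<longleftrightarrow>
     refines (points k) p q \<and> refines (points k) p' q \<and>
     (\<forall>r. refines (points k) p r \<and> refines (points k) p' r \<longrightarrow> refines (points k) q r)"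

definition pjoin :: "nat \<Rightarrow> diagram \<Rightarrow> diagram \<Rightarrow> diagram" where
  "pjoin k p p' = (THE q. is_pjoin k p p' q)"

lemma pjoin_ex1:
  assumes p: "p \<in> Part k" and p': "p' \<in> Part k"
  shows "\<exists>!q. is_pjoin k p p' q"
proof -
  let ?A = "points k"
  define C where "C = {r. refines ?A p r \<and> refines ?A p' r}"
  define S where "S = {(x, y). x \<in> ?A \<and> y \<in> ?A \<and> (\<forall>r\<in>C. \<exists>B\<in>r. x \<in> B \<and> y \<in> B)}"
  have part: "partition_on ?A r" if "r \<in> C" for r
    using that by (auto simp: C_def refines_def)
  have uniq: "B = B'" if "r \<in> C" "B \<in> r" "B' \<in> r" "y \<in> B" "y \<in> B'" for r B B' y
    using part[OF that(1)] that(2-) by (auto simp: partition_on_def pairwise_def disjnt_def)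
  have eq: "equiv ?A S"
  proof (rule equivI)
    show "refl_on ?A S"
    proof (rule refl_onI)
      fix x assume x: "x \<in> ?A"
      have "\<exists>B\<in>r. x \<in> B \<and> x \<in> B" if "r \<in> C" for r
        using part[OF that] x by (auto simp: partition_on_def)
      then show "(x, x) \<in> S" using x by (simp add: S_def)
    qed
    show "sym S"
      by (auto simp: sym_def S_def)
    show "trans S"
    proof (rule transI)
      fix x y z assume xy: "(x, y) \<in> S" and yz: "(y, z) \<in> S"
      have "\<exists>B\<in>r. x \<in> B \<and> z \<in> B" if r: "r \<in> C" for r
      proof -
        obtain B where B: "B \<in> r" "x \<in> B" "y \<in> B"
          using xy r by (auto simp: S_def)
        obtain B' where B': "B' \<in> r" "y \<in> B'" "z \<in> B'"
          using yz r by (auto simp: S_def)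
        show ?thesis
          using uniq[OF r B(1) B'(1) B(3) B'(2)] B B' by blast
      qed
      then show "(x, z) \<in> S" using xy yz by (auto simp: S_def)
    qed
    show "S \<subseteq> ?A \<times> ?A" by (auto simp: S_def)
  qed
  define q where "q = ?A // S"
  have q: "partition_on ?A q"
    unfolding q_def by (rule partition_on_quotient[OF eq])
  have below: "refines ?A u q" if u: "partition_on ?A u" "\<And>r. r \<in> C \<Longrightarrow> refines ?A u r" for u
  proof -
    have "\<exists>Y\<in>q. X \<subseteq> Y" if X: "X \<in> u" for X
    proof -
      obtain x where x: "x \<in> X" "x \<in> ?A"
        using X u(1) unfolding partition_on_def by (metis UnionI ex_in_conv)
      have "X \<subseteq> ?A" using X u(1) by (auto simp: partition_on_def)
      moreover have "\<exists>B\<in>r. x \<in> B \<and> y \<in> B" if r: "r \<in> C" and y: "y \<in> X" for r y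
      proof -
        obtain B where "B \<in> r" "X \<subseteq> B"
          using u(2)[OF r] X by (auto simp: refines_def)
        then show ?thesis using x y by blast
      qed
      ultimately have "X \<subseteq> S `` {x}"
        using x unfolding S_def by blast
      moreover have "S `` {x} \<in> q" using x by (auto simp: q_def quotient_def)
      ultimately show ?thesis by blast
    qed
    then show ?thesis using u(1) q by (auto simp: refines_def)
  qed
  have above: "refines ?A q r" if r: "r \<in> C" for r
  proof -
    have "\<exists>Y\<in>r. X \<subseteq> Y" if X: "X \<in> q" for X
    proof -
      obtain x where x: "x \<in> ?A" "X = S `` {x}" using X by (auto simp: q_def quotient_def)
      obtain B where B: "B \<in> r" "x \<in> B" using part[OF r] x by (auto simp: partition_on_def)
      have "X \<subseteq> B"
      proof
        fix y assume "y \<in> X"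
        then obtain B' where B': "B' \<in> r" "x \<in> B'" "y \<in> B'"
          using x r by (auto simp: S_def)
        then show "y \<in> B" using uniq[OF r B(1) B'(1) B(2) B'(2)] by simp
      qed
      then show ?thesis using B by blast
    qed
    then show ?thesis using q part[OF r] by (auto simp: refines_def)
  qed
  have "is_pjoin k p p' q"
    using below[of p] below[of p'] above p p' by (auto simp: is_pjoin_def C_def Part_def)
  moreover have "q1 = q2" if "is_pjoin k p p' q1" "is_pjoin k p p' q2" for q1 q2
    using that unfolding is_pjoin_def by (meson refines_asym)
  ultimately show ?thesis by blast
qed

definition id_part :: "nat \<Rightarrow> diagram" where
  "id_part k = (\<lambda>i. {Inl i, Inr i}) ` {1..k}"

definition ptranspose :: "diagram \<Rightarrow> diagram" where
  "ptranspose p = (\<lambda>B. case_sum Inr Inl ` B) ` p"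

definition pdist :: "nat \<Rightarrow> diagram \<Rightarrow> diagram \<Rightarrow> real" where
  "pdist k p p' = (real (nc p) + real (nc p')) / 2 - real (nc (pjoin k p p'))"

definition ple :: "nat \<Rightarrow> diagram \<Rightarrow> diagram \<Rightarrow> bool" where
  "ple k p p' \<longleftrightarrow> pdist k (id_part k) p + pdist k p p' = pdist k (id_part k) p'"

definition perm_act :: "(nat \<Rightarrow> nat) \<Rightarrow> diagram \<Rightarrow> diagram" where
  "perm_act \<sigma> p = (\<lambda>B. map_sum \<sigma> \<sigma> ` B) ` p"

text \<open>On \<open>I\<close>, the map \<open>rank_in I\<close> is the increasing bijection onto \<open>{1..card I}\<close>.\<close>

definition rank_in :: "nat set \<Rightarrow> nat \<Rightarrow> nat" where
  "rank_in I i = card {j \<in> I. j \<le> i}"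

definition prestrict :: "diagram \<Rightarrow> nat set \<Rightarrow> diagram" where
  "prestrict p I =
     (\<lambda>B. map_sum (rank_in I) (rank_in I) ` B) ` ({B \<inter> (I <+> I) | B. B \<in> p} - {{}})"

text \<open>A linear form on \<open>\<complex>[Part k / S\<^sub>k]\<close> is given by its values on the orbits, that is, by a function
  on \<open>Part k\<close> that is constant on orbits. A linear form on the direct sum of these spaces is a
  family indexed by \<open>k\<close>. Values outside \<open>Part k\<close> carry no meaning.\<close>

definition is_form :: "nat \<Rightarrow> (diagram \<Rightarrow> complex) \<Rightarrow> bool" where
  "is_form k \<phi> \<longleftrightarrow> (\<forall>p\<in>Part k. \<forall>\<sigma>. \<sigma> permutes {1..k} \<longrightarrow> \<phi> (perm_act \<sigma> p) = \<phi> p)"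

type_synonym forms = "nat \<Rightarrow> diagram \<Rightarrow> complex"

definition extend2 :: "(diagram \<Rightarrow> complex) \<Rightarrow> forms" where
  "extend2 \<phi> = (\<lambda>k p. if k = 2 then \<phi> p else 0)"

definition boxplus :: "forms \<Rightarrow> forms \<Rightarrow> forms" where
  "boxplus \<phi>1 \<phi>2 = (\<lambda>k p.
     \<Sum>I | I \<subseteq> {1..k} \<and> nc (prestrict p I) + nc (prestrict p ({1..k} - I)) = nc p.
       \<phi>1 (card I) (prestrict p I) * \<phi>2 (card ({1..k} - I)) (prestrict p ({1..k} - I)))"

definition boxunit :: forms where
  "boxunit = (\<lambda>k p. if p = {} then 1 else 0)"

definition boxpower :: "forms \<Rightarrow> nat \<Rightarrow> forms" where
  "boxpower \<phi> n = (boxplus \<phi> ^^ n) boxunit"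

definition boxexp :: "forms \<Rightarrow> forms" where
  "boxexp \<phi> = (\<lambda>k p. \<Sum>n. boxpower \<phi> n k p / fact n)"

text \<open>A distribution is represented by its moments \<open>m k p\<close> for \<open>p \<in> Part k\<close>.\<close>

definition has_R_transform :: "forms \<Rightarrow> forms \<Rightarrow> bool" where
  "has_R_transform m R \<longleftrightarrow>
     (\<forall>k. \<forall>p\<in>Part k. m k p = (\<Sum>p' | p' \<in> Part k \<and> ple k p' p. R k p'))"

definition P_Gaussian :: "forms \<Rightarrow> bool" where
  "P_Gaussian m \<longleftrightarrow>
     (\<exists>R. has_R_transform m R \<and> (\<forall>k. \<forall>p\<in>Part k. R k p = boxexp (extend2 (R 2)) k p))"

text \<open>Since the dimensions \<open>N\<close> and \<open>N\<^sup>k\<close> vary, a matrix is a function of a row and a column index,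
  relevant only on a finite index set \<open>X\<close>: \<open>{1..N}\<close> for operators on \<open>\<complex>\<^sup>N\<close>, and the multi-indices
  \<open>(i\<^sub>1, \<dots>, i\<^sub>k)\<close> for operators on its \<open>k\<close>-th tensor power.\<close>

type_synonym 'i cmatrix = "'i \<Rightarrow> 'i \<Rightarrow> complex"

definition mat_mult :: "'i set \<Rightarrow> 'i cmatrix \<Rightarrow> 'i cmatrix \<Rightarrow> 'i cmatrix" where
  "mat_mult X A B = (\<lambda>r c. \<Sum>l\<in>X. A r l * B l c)"

definition mat_trace :: "'i set \<Rightarrow> 'i cmatrix \<Rightarrow> complex" where
  "mat_trace X A = (\<Sum>i\<in>X. A i i)"

definition unit_mat :: "nat \<Rightarrow> nat \<Rightarrow> nat cmatrix" where
  "unit_mat i j = (\<lambda>r c. if r = i \<and> c = j then 1 else 0)"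

definition multi_indices :: "nat \<Rightarrow> nat \<Rightarrow> (nat \<Rightarrow> nat) set" where
  "multi_indices k N = {1..k} \<rightarrow>\<^sub>E {1..N}"

definition tensor :: "nat \<Rightarrow> (nat \<Rightarrow> nat cmatrix) \<Rightarrow> (nat \<Rightarrow> nat) cmatrix" where
  "tensor k A = (\<lambda>r c. \<Prod>l = 1..k. A l (r l) (c l))"

text \<open>\<open>unit_mat i j\<close> is \<open>E\<^sub>i\<^sup>j\<close>, hence the bottom label gives the row and the top label the column.\<close>

definition rho :: "nat \<Rightarrow> nat \<Rightarrow> diagram \<Rightarrow> (nat \<Rightarrow> nat) cmatrix" where
  "rho N k p = (\<lambda>r c.
     \<Sum>i | i \<in> points k \<rightarrow>\<^sub>E {1..N} \<and> (\<forall>B\<in>p. \<forall>a\<in>B. \<forall>b\<in>B. i a = i b).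
       tensor k (\<lambda>l. unit_mat (i (Inr l)) (i (Inl l))) r c)"

definition random_matrix :: "'w measure \<Rightarrow> nat \<Rightarrow> ('w \<Rightarrow> nat cmatrix) \<Rightarrow> bool" where
  "random_matrix \<Omega> N M \<longleftrightarrow>
     (\<forall>i\<in>{1..N}. \<forall>j\<in>{1..N}.
        (\<lambda>\<omega>. M \<omega> i j) \<in> borel_measurable \<Omega> \<and>
        (\<forall>n. integrable \<Omega> (\<lambda>\<omega>. cmod (M \<omega> i j) ^ n)))"

definition E_moment :: "'w measure \<Rightarrow> nat \<Rightarrow> ('w \<Rightarrow> nat cmatrix) \<Rightarrow> forms" where
  "E_moment \<Omega> N M = (\<lambda>k p.
     (1 / of_nat N ^ nc (pjoin k p (id_part k))) *
     (LINT \<omega>|\<Omega>. mat_trace (multi_indices k N)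
        (mat_mult (multi_indices k N) (tensor k (\<lambda>_. M \<omega>)) (rho N k (ptranspose p)))))"

definition converges_in_P_distribution ::
  "'w measure \<Rightarrow> (nat \<Rightarrow> 'w \<Rightarrow> nat cmatrix) \<Rightarrow> forms \<Rightarrow> bool" where
  "converges_in_P_distribution \<Omega> M m \<longleftrightarrow>
     (\<forall>k. \<forall>p\<in>Part k. (\<lambda>N. E_moment \<Omega> N (M N) k p) \<longlonglongrightarrow> m k p)"

end

theory Submission
  imports Defs
begin

text \<open>
The matrices are Gaussian. Let \<open>M\<^sub>N\<close> be a centered complex Gaussian matrix with
\[ E [M (r, c) M (r', c')] = \sum_q \phi (q) N^{- (nc (q) - nc (q \vee id))}, \]
the sum being over the partitions \<open>q\<close> of \<open>{1, 2, 1', 2'}\<close> on whose blocks the labels \<open>c, c', r, r'\<close>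
are constant. Only expectations of polynomials in the entries, never in their conjugates, enter the
moments; so the right-hand side may be any symmetric complex matrix indexed by the positions: each
such matrix is \<open>A A\<^sup>T\<close> for some complex \<open>A\<close> (\<open>symmetric_factorization\<close>), and the entries of
\<open>M\<^sub>N\<close> are the linear forms given by the rows of \<open>A\<close> in independent real normal variables. Symmetry
is what the invariance of \<open>\<phi>\<close> under the exchange of 1 and 2 provides (\<open>entry_cov_sym\<close>).

By Wick's formula, the expectation of a product of \<open>k\<close> entries is a sum over the pairings of
\<open>{1..k}\<close> and, for each pair, over the partitions that sit on it. The union of these partitions is a
partition \<open>q\<close> of the \<open>2 k\<close> points, and summing over the pairings that produce the same \<open>q\<close> gives
exactly \<open>boxexp (extend2 \<phi>) k q\<close>, since \<open>nc (q)\<close> and \<open>nc (q \<or> id)\<close> are additive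
(\<open>expectation_entries\<close>). Pairings never appear explicitly: both Wick's formula and the powers for
\<open>boxplus\<close> are governed by the recursion that removes one pair in all possible ways, and
\<open>n!\<close> is the number of orders in which the \<open>n\<close> pairs can be removed.

The trace against \<open>\<rho>\<^sub>N (p)\<close> then counts the labellings that are constant on the blocks of \<open>q\<close> and
of \<open>p\<close>; there are \<open>N\<close> to the power \<open>nc (q \<or> p)\<close> of them. Hence, for every \<open>N \<ge> 1\<close>,
\[ E m_p (M_N) = \sum_q boxexp (q) N^{nc (q \vee id) + nc (q \vee p) - nc (q) - nc (p \vee id)}. \]
The exponent is at most 0 by the triangle inequality for \<open>pdist\<close> (\<open>nc_pjoin_triangle\<close>), and it
vanishes precisely when \<open>q \<le> p\<close> (\<open>ple_iff\<close>). So the limit is the sum of \<open>boxexp (q)\<close> over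
\<open>q \<le> p\<close>.

All facts about numbers of blocks are obtained by counting: maps into a set of size \<open>x\<close> that are
constant on the blocks of a partition with \<open>n\<close> blocks number \<open>x ^ n\<close>, and being constant on the
blocks of a join means being constant on the blocks of both partitions.
\<close>

section \<open>Counting maps that are constant on blocks\<close>

text \<open>\<open>Q\<close> is an arbitrary family of sets and need not be a partition. Therefore a union of two families
expresses being constant on the blocks of two partitions at once.\<close>

definition block_maps :: "'a set \<Rightarrow> 'b set \<Rightarrow> 'a set set \<Rightarrow> ('a \<Rightarrow> 'b) set" where
  "block_maps A X Q = {f \<in> A \<rightarrow>\<^sub>E X. \<forall>B\<in>Q. \<forall>a\<in>B. \<forall>b\<in>B. f a = f b}"

lemma block_maps_PiE: "f \<in> block_maps A X Q \<Longrightarrow> f \<in> A \<rightarrow>\<^sub>E X"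
  and block_maps_eq: "f \<in> block_maps A X Q \<Longrightarrow> B \<in> Q \<Longrightarrow> a \<in> B \<Longrightarrow> b \<in> B \<Longrightarrow> f a = f b"
  and block_mapsI: "f \<in> A \<rightarrow>\<^sub>E X \<Longrightarrow> (\<And>B a b. B \<in> Q \<Longrightarrow> a \<in> B \<Longrightarrow> b \<in> B \<Longrightarrow> f a = f b) \<Longrightarrow>
    f \<in> block_maps A X Q"
  unfolding block_maps_def by blast+

lemma block_maps_Un: "block_maps A X (P \<union> R) = block_maps A X P \<inter> block_maps A X R"
  unfolding block_maps_def ball_Un by (rule set_eqI) (simp only: Int_iff mem_Collect_eq, fast)

lemma block_maps_undefined: "f \<in> block_maps A X Q \<Longrightarrow> a \<notin> A \<Longrightarrow> f a = undefined"
  using PiE_arb[OF block_maps_PiE] .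

lemma finite_block_maps [simp]: "finite A \<Longrightarrow> finite X \<Longrightarrow> finite (block_maps A X Q)"
  unfolding block_maps_def by (rule finite_subset[OF _ finite_PiE[of A "\<lambda>_. X"]]) auto

lemma card_block_maps_partition:
  assumes A: "finite A" and q: "partition_on A Q"
  shows "card (block_maps A X Q) = card X ^ card Q"
proof -
  define bl where "bl a = (THE B. B \<in> Q \<and> a \<in> B)" for a
  have bl: "bl a = B" if "B \<in> Q" "a \<in> B" for a B
    unfolding bl_def using that q
    by (intro the_equality) (auto simp: partition_on_def pairwise_def disjnt_def)
  have blQ: "bl a \<in> Q" "a \<in> bl a" if "a \<in> A" for a
    using that q bl by (auto simp: partition_on_def)
  have QA: "B \<subseteq> A" if "B \<in> Q" for B using that q by (auto simp: partition_on_def)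
  have finQ: "finite Q" using A q by (rule finite_elements)
  define rep where "rep B = (SOME a. a \<in> B)" for B :: "'a set"
  have rep: "rep B \<in> B" "rep B \<in> A" if "B \<in> Q" for B
  proof -
    have "B \<noteq> {}" "B \<subseteq> A" using that q by (auto simp: partition_on_def)
    then show "rep B \<in> B" unfolding rep_def by (auto intro: someI)
    then show "rep B \<in> A" using \<open>B \<subseteq> A\<close> by auto
  qed
  have "bij_betw (\<lambda>f. \<lambda>B\<in>Q. f (rep B)) (block_maps A X Q) (Q \<rightarrow>\<^sub>E X)"
  proof (rule bij_betw_byWitness[where f' = "\<lambda>g. \<lambda>a\<in>A. g (bl a)"])
    show "\<forall>f\<in>block_maps A X Q. (\<lambda>a\<in>A. (\<lambda>B\<in>Q. f (rep B)) (bl a)) = f"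
    proof (intro ballI ext)
      fix f a assume f: "f \<in> block_maps A X Q"
      show "(\<lambda>a\<in>A. (\<lambda>B\<in>Q. f (rep B)) (bl a)) a = f a"
      proof (cases "a \<in> A")
        case True
        then show ?thesis
          using block_maps_eq[OF f, of "bl a" "rep (bl a)" a] blQ[OF True] rep by simp
      next
        case False
        then show ?thesis using block_maps_undefined[OF f] by simp
      qed
    qed
    show "\<forall>g\<in>Q \<rightarrow>\<^sub>E X. (\<lambda>B\<in>Q. (\<lambda>a\<in>A. g (bl a)) (rep B)) = g"
    proof (intro ballI ext)
      fix g B assume g: "g \<in> Q \<rightarrow>\<^sub>E X"
      show "(\<lambda>B\<in>Q. (\<lambda>a\<in>A. g (bl a)) (rep B)) B = g B"
        using rep[of B] bl[of B "rep B"] PiE_arb[OF g] by (cases "B \<in> Q") simp_all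
    qed
    show "(\<lambda>f. \<lambda>B\<in>Q. f (rep B)) ` block_maps A X Q \<subseteq> Q \<rightarrow>\<^sub>E X"
      using rep by (auto dest!: block_maps_PiE)
    show "(\<lambda>g. \<lambda>a\<in>A. g (bl a)) ` (Q \<rightarrow>\<^sub>E X) \<subseteq> block_maps A X Q"
    proof (intro image_subsetI block_mapsI)
      fix g B a b assume "B \<in> Q" "a \<in> B" "b \<in> B"
      then show "(\<lambda>a\<in>A. g (bl a)) a = (\<lambda>a\<in>A. g (bl a)) b"
        using QA[of B] bl[of B a] bl[of B b] by auto
    qed (use blQ in auto)
  qed
  then show ?thesis
    using finQ by (simp add: bij_betw_same_card card_PiE)
qed

lemma card_block_maps_Un:
  assumes dj: "A \<inter> A' = {}" and Q: "\<Union>Q \<subseteq> A" and Q': "\<Union>Q' \<subseteq> A'"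
  shows "card (block_maps (A \<union> A') X (Q \<union> Q')) =
         card (block_maps A X Q) * card (block_maps A' X Q')"
proof -
  have 1: "a \<in> A" if "B \<in> Q" "a \<in> B" for a B using that Q by auto
  have 2: "a \<in> A'" "a \<notin> A" if "B \<in> Q'" "a \<in> B" for a B using that Q' dj by auto
  have "bij_betw (\<lambda>f. (restrict f A, restrict f A')) (block_maps (A \<union> A') X (Q \<union> Q'))
     (block_maps A X Q \<times> block_maps A' X Q')"
  proof (rule bij_betw_byWitness[where f' = "\<lambda>(f, g) a. if a \<in> A then f a else g a"])
    show "\<forall>f\<in>block_maps (A \<union> A') X (Q \<union> Q').
       (\<lambda>(f, g) a. if a \<in> A then f a else g a) (restrict f A, restrict f A') = f"
      by (auto simp: fun_eq_iff dest: block_maps_undefined)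
    show "\<forall>a'\<in>block_maps A X Q \<times> block_maps A' X Q'.
       (restrict ((\<lambda>(f, g) a. if a \<in> A then f a else g a) a') A,
        restrict ((\<lambda>(f, g) a. if a \<in> A then f a else g a) a') A') = a'"
      using dj by (auto simp: fun_eq_iff dest: block_maps_undefined)
    show "(\<lambda>f. (restrict f A, restrict f A')) ` block_maps (A \<union> A') X (Q \<union> Q')
       \<subseteq> block_maps A X Q \<times> block_maps A' X Q'"
    proof (intro image_subsetI SigmaI block_mapsI)
      fix f assume f: "f \<in> block_maps (A \<union> A') X (Q \<union> Q')"
      show "restrict f A \<in> A \<rightarrow>\<^sub>E X" "restrict f A' \<in> A' \<rightarrow>\<^sub>E X"
        using block_maps_PiE[OF f] by auto
      show "restrict f A a = restrict f A b" if "B \<in> Q" "a \<in> B" "b \<in> B" for B a b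
        using that 1 block_maps_eq[OF f, of B a b] by simp
      show "restrict f A' a = restrict f A' b" if "B \<in> Q'" "a \<in> B" "b \<in> B" for B a b
        using that 2 block_maps_eq[OF f, of B a b] by simp
    qed
    show "(\<lambda>(f, g) a. if a \<in> A then f a else g a) ` (block_maps A X Q \<times> block_maps A' X Q')
       \<subseteq> block_maps (A \<union> A') X (Q \<union> Q')"
    proof (clarify, intro block_mapsI)
      fix f g assume f: "f \<in> block_maps A X Q" and g: "g \<in> block_maps A' X Q'"
      show "(\<lambda>a. if a \<in> A then f a else g a) \<in> A \<union> A' \<rightarrow>\<^sub>E X"
        using block_maps_PiE[OF f] block_maps_PiE[OF g] by (auto simp: PiE_iff extensional_def)
      fix B a b assume ab: "B \<in> Q \<union> Q'" "a \<in> B" "b \<in> B"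
      then show "(if a \<in> A then f a else g a) = (if b \<in> A then f b else g b)"
        using 1 2 block_maps_eq[OF f, of B a b] block_maps_eq[OF g, of B a b] by auto
    qed
  qed
  then show ?thesis by (simp add: bij_betw_same_card card_cartesian_product)
qed

lemma card_block_maps_image:
  assumes h: "bij_betw h A A'" and Q: "\<Union>Q \<subseteq> A"
  shows "card (block_maps A' X ((`) h ` Q)) = card (block_maps A X Q)"
proof -
  have inv: "inv_into A h (h a) = a" if "a \<in> A" for a
    using that h by (simp add: bij_betw_def)
  have inv': "h (inv_into A h b) = b" "inv_into A h b \<in> A" if "b \<in> A'" for b
    using that h by (auto simp: bij_betw_def f_inv_into_f inv_into_into)
  have hA: "h a \<in> A'" if "a \<in> A" for a using that h by (auto simp: bij_betw_def)
  have QA: "a \<in> A" if "B \<in> Q" "a \<in> B" for a B using that Q by auto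
  have "bij_betw (\<lambda>f. \<lambda>a\<in>A. f (h a)) (block_maps A' X ((`) h ` Q)) (block_maps A X Q)"
  proof (rule bij_betw_byWitness[where f' = "\<lambda>g. \<lambda>b\<in>A'. g (inv_into A h b)"])
    show "\<forall>f\<in>block_maps A' X ((`) h ` Q). (\<lambda>b\<in>A'. (\<lambda>a\<in>A. f (h a)) (inv_into A h b)) = f"
      using inv' by (auto simp: fun_eq_iff dest: block_maps_undefined)
    show "\<forall>g\<in>block_maps A X Q. (\<lambda>a\<in>A. (\<lambda>b\<in>A'. g (inv_into A h b)) (h a)) = g"
      using inv hA by (auto simp: fun_eq_iff dest: block_maps_undefined)
    show "(\<lambda>f. \<lambda>a\<in>A. f (h a)) ` block_maps A' X ((`) h ` Q) \<subseteq> block_maps A X Q"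
    proof (intro image_subsetI block_mapsI)
      fix f assume f: "f \<in> block_maps A' X ((`) h ` Q)"
      show "(\<lambda>a\<in>A. f (h a)) \<in> A \<rightarrow>\<^sub>E X" using block_maps_PiE[OF f] hA by auto
      fix B a b assume "B \<in> Q" "a \<in> B" "b \<in> B"
      then show "(\<lambda>a\<in>A. f (h a)) a = (\<lambda>a\<in>A. f (h a)) b"
        using QA block_maps_eq[OF f, of "h ` B" "h a" "h b"] by auto
    qed
    show "(\<lambda>g. \<lambda>b\<in>A'. g (inv_into A h b)) ` block_maps A X Q \<subseteq> block_maps A' X ((`) h ` Q)"
    proof (intro image_subsetI block_mapsI)
      fix g assume g: "g \<in> block_maps A X Q"
      show "(\<lambda>b\<in>A'. g (inv_into A h b)) \<in> A' \<rightarrow>\<^sub>E X" using block_maps_PiE[OF g] inv' by auto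
      fix B a b assume "B \<in> (`) h ` Q" "a \<in> B" "b \<in> B"
      then obtain B' a' b' where "B' \<in> Q" "a' \<in> B'" "b' \<in> B'" "a = h a'" "b = h b'" by auto
      then show "(\<lambda>b\<in>A'. g (inv_into A h b)) a = (\<lambda>b\<in>A'. g (inv_into A h b)) b"
        using QA inv hA block_maps_eq[OF g, of B' a' b'] by simp
    qed
  qed
  then show ?thesis by (rule bij_betw_same_card)
qed

text \<open>The maps into the field with two elements that are constant on the blocks of a family form a vector
space. With \<open>V\<close> and \<open>W\<close> the spaces for \<open>Q \<union> R\<close> and \<open>Q \<union> P\<close>, the sum \<open>V + W\<close> lies in the space of
\<open>Q\<close>, the intersection \<open>V \<inter> W\<close> lies in that of \<open>P \<union> R\<close>, and
\<open>|V| |W| = |V + W| |V \<inter> W|\<close>. The proof makes this explicit by an injection: a pair \<open>(f, g)\<close> goes to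
\<open>f + g\<close> and to the difference of \<open>f\<close> with a chosen first summand of \<open>f + g\<close>.\<close>

lemma card_block_maps_modular:
  assumes A: "finite A" and Q: "\<Union>Q \<subseteq> A" and R: "\<Union>R \<subseteq> A" and P: "\<Union>P \<subseteq> A"
  shows "card (block_maps A (UNIV :: bool set) (Q \<union> R)) * card (block_maps A (UNIV :: bool set) (Q \<union> P))
       \<le> card (block_maps A (UNIV :: bool set) Q) * card (block_maps A (UNIV :: bool set) (P \<union> R))"
proof -
  let ?V = "block_maps A (UNIV :: bool set)"
  define s where "s f g = (\<lambda>a\<in>A. f a \<noteq> g a)" for f g :: "'a \<Rightarrow> bool"
  have s_in: "s f g \<in> ?V S" if f: "f \<in> ?V S" and g: "g \<in> ?V S" and S: "\<Union>S \<subseteq> A" for f g S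
  proof (rule block_mapsI)
    fix B a b assume *: "B \<in> S" "a \<in> B" "b \<in> B"
    then have "a \<in> A" "b \<in> A" using S by auto
    then show "s f g a = s f g b"
      using block_maps_eq[OF f *] block_maps_eq[OF g *] by (simp add: s_def)
  qed (simp add: s_def)
  have mono: "f \<in> ?V S'" if "f \<in> ?V S" "S' \<subseteq> S" for f S S'
    using that unfolding block_maps_def by blast
  have s_cancel: "g = g'" if "s f g = s f g'" "g \<in> ?V S" "g' \<in> ?V S'" for f g g' S S'
  proof
    fix a
    show "g a = g' a"
      using fun_cong[OF that(1), of a] block_maps_undefined[OF that(2)] block_maps_undefined[OF that(3)]
      by (cases "a \<in> A") (auto simp: s_def)
  qed
  have s_swap: "s f f' = s g g'" if "s f g = s f' g'" for f g f' g'
  proof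
    fix a
    show "s f f' a = s g g' a"
      using fun_cong[OF that, of a] by (cases "a \<in> A") (auto simp: s_def)
  qed
  \<comment> \<open>the chosen first summand of \<open>h\<close>\<close>
  define base where "base h = (SOME f. f \<in> ?V (Q \<union> R) \<and> (\<exists>g \<in> ?V (Q \<union> P). s f g = h))" for h
  have base: "base (s f g) \<in> ?V (Q \<union> R)" "\<exists>g' \<in> ?V (Q \<union> P). s (base (s f g)) g' = s f g"
    if "f \<in> ?V (Q \<union> R)" "g \<in> ?V (Q \<union> P)" for f g
  proof -
    have "\<exists>f'. f' \<in> ?V (Q \<union> R) \<and> (\<exists>g' \<in> ?V (Q \<union> P). s f' g' = s f g)" using that by blast
    from someI_ex[OF this]
    show "base (s f g) \<in> ?V (Q \<union> R)" "\<exists>g' \<in> ?V (Q \<union> P). s (base (s f g)) g' = s f g"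
      by (auto simp: base_def)
  qed
  define F where "F = (\<lambda>(f, g). (s f g, s (base (s f g)) f))"
  have "card (?V (Q \<union> R) \<times> ?V (Q \<union> P)) \<le> card (?V Q \<times> ?V (P \<union> R))"
  proof (rule card_inj_on_le[of F])
    show "inj_on F (?V (Q \<union> R) \<times> ?V (Q \<union> P))"
    proof (rule inj_onI, clarify)
      fix f g f' g'
      assume *: "f \<in> ?V (Q \<union> R)" "g \<in> ?V (Q \<union> P)" "f' \<in> ?V (Q \<union> R)" "g' \<in> ?V (Q \<union> P)"
        and "F (f, g) = F (f', g')"
      then have e1: "s f g = s f' g'" and e2: "s (base (s f g)) f = s (base (s f' g')) f'"
        unfolding F_def prod.case prod.inject by blast+
      have e: "s f g = s f' g'" "s (base (s f g)) f = s (base (s f g)) f'"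
        using e1 e2 by simp_all
      have "f = f'" using s_cancel[OF e(2)] * by blast
      then show "f = f' \<and> g = g'" using e(1) * s_cancel by blast
    qed
    show "F ` (?V (Q \<union> R) \<times> ?V (Q \<union> P)) \<subseteq> ?V Q \<times> ?V (P \<union> R)"
    proof (rule image_subsetI)
      fix x assume "x \<in> ?V (Q \<union> R) \<times> ?V (Q \<union> P)"
      then obtain f g where x: "x = (f, g)" and *: "f \<in> ?V (Q \<union> R)" "g \<in> ?V (Q \<union> P)" by blast
      define a b where ab: "a = s f g" "b = s (base (s f g)) f"
      obtain g' where g': "g' \<in> ?V (Q \<union> P)" "s (base (s f g)) g' = s f g"
        using base(2)[OF *] by blast
      have "b \<in> ?V R"
        unfolding ab by (rule s_in[OF mono[OF base(1)[OF *]] mono[OF *(1)] R]) auto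
      moreover have "b = s g' g"
        using ab(2) s_swap[OF g'(2)] by (rule trans)
      then have "b \<in> ?V P"
        using s_in[OF mono[OF g'(1), of P] mono[OF *(2), of P] P] by simp
      moreover have "a \<in> ?V Q"
        unfolding ab by (rule s_in[OF mono[OF *(1)] mono[OF *(2)] Q]) auto
      ultimately have "(a, b) \<in> ?V Q \<times> ?V (P \<union> R)"
        by (simp add: block_maps_Un)
      then show "F x \<in> ?V Q \<times> ?V (P \<union> R)"
        by (simp only: x F_def prod.case ab)
    qed
  qed (use A in auto)
  then show ?thesis by (simp add: card_cartesian_product)
qed

section \<open>Joins and the order on partitions\<close>

text \<open>A map that is constant on the blocks of \<open>p\<close> and of \<open>p'\<close> has fibres that form a partition coarser
than both, hence coarser than the join.\<close>

lemma block_maps_pjoin: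
  assumes p: "p \<in> Part k" and p': "p' \<in> Part k"
  shows "block_maps (points k) X (p \<union> p') = block_maps (points k) X (pjoin k p p')"
proof -
  let ?j = "pjoin k p p'"
  have j: "is_pjoin k p p' ?j"
    unfolding pjoin_def by (rule theI'[OF pjoin_ex1[OF p p']])
  have "(\<forall>B\<in>p \<union> p'. \<forall>a\<in>B. \<forall>b\<in>B. f a = f b) \<longleftrightarrow> (\<forall>B\<in>?j. \<forall>a\<in>B. \<forall>b\<in>B. f a = f b)"
    for f :: "nat + nat \<Rightarrow> 'a"
  proof
    assume *: "\<forall>B\<in>?j. \<forall>a\<in>B. \<forall>b\<in>B. f a = f b"
    have "\<exists>Y\<in>?j. B \<subseteq> Y" if "B \<in> p \<union> p'" for B
      using that j unfolding is_pjoin_def refines_def by blast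
    then show "\<forall>B\<in>p \<union> p'. \<forall>a\<in>B. \<forall>b\<in>B. f a = f b" using * by blast
  next
    assume *: "\<forall>B\<in>p \<union> p'. \<forall>a\<in>B. \<forall>b\<in>B. f a = f b"
    define r where "r = (\<lambda>x. {a \<in> points k. f a = x}) ` f ` points k"
    have r: "partition_on (points k) r"
      by (auto simp: r_def partition_on_def pairwise_def disjnt_def)
    have "refines (points k) u r" if u: "partition_on (points k) u" "u \<subseteq> p \<union> p'" for u
    proof -
      have "\<exists>Y\<in>r. B \<subseteq> Y" if B: "B \<in> u" for B
      proof -
        have "B \<noteq> {}" "B \<subseteq> points k" using B u by (auto simp: partition_on_def)
        then obtain b where "b \<in> B" "b \<in> points k" by auto
        have "{c \<in> points k. f c = f b} \<in> r" using \<open>b \<in> points k\<close> by (auto simp: r_def)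
        moreover have "f c = f b" if "c \<in> B" for c
          using *[rule_format, of B c b] B u(2) \<open>b \<in> B\<close> that by blast
        then have "B \<subseteq> {c \<in> points k. f c = f b}" using \<open>B \<subseteq> points k\<close> by blast
        ultimately show ?thesis by blast
      qed
      then show ?thesis using u r unfolding refines_def by blast
    qed
    then have "refines (points k) ?j r"
      using j p p' unfolding is_pjoin_def Part_def by blast
    then have "\<exists>x. B \<subseteq> {a \<in> points k. f a = x}" if "B \<in> ?j" for B
      using that unfolding refines_def r_def by blast
    then show "\<forall>B\<in>?j. \<forall>a\<in>B. \<forall>b\<in>B. f a = f b" by (metis (mono_tags, lifting) mem_Collect_eq subsetD)
  qed
  then show ?thesis by (simp add: block_maps_def)
qed

lemma pjoin_in_Part:
  assumes "p \<in> Part k" "p' \<in> Part k"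
  shows "pjoin k p p' \<in> Part k"
proof -
  have "is_pjoin k p p' (pjoin k p p')"
    unfolding pjoin_def by (rule theI'[OF pjoin_ex1[OF assms]])
  then show ?thesis by (simp add: is_pjoin_def refines_def Part_def)
qed

lemma finite_points [simp]: "finite (points k)"
  by (simp add: points_def)

lemma card_block_maps_Part:
  assumes "p \<in> Part k"
  shows "card (block_maps (points k) X p) = card X ^ nc p"
  using assms card_block_maps_partition[of "points k" p X] by (simp add: Part_def nc_def)

lemma card_block_maps_join:
  assumes "p \<in> Part k" "p' \<in> Part k"
  shows "card (block_maps (points k) X (p \<union> p')) = card X ^ nc (pjoin k p p')"
  using assms by (simp add: block_maps_pjoin card_block_maps_Part pjoin_in_Part)

lemma id_part_in_Part: "id_part k \<in> Part k"
  unfolding Part_def mem_Collect_eq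
proof (rule partition_onI)
  show "\<Union>(id_part k) = points k" by (auto simp: id_part_def points_def)
  show "disjnt B B'" if "B \<in> id_part k" "B' \<in> id_part k" "B \<noteq> B'" for B B'
    using that by (auto simp: id_part_def disjnt_def)
  show "{} \<notin> id_part k" by (auto simp: id_part_def)
qed

lemma pjoin_commute: "pjoin k p p' = pjoin k p' p"
proof -
  have "is_pjoin k p p' q \<longleftrightarrow> is_pjoin k p' p q" for q
    unfolding is_pjoin_def by blast
  then show ?thesis by (simp add: pjoin_def)
qed

text \<open>The triangle inequality for \<open>pdist\<close> between \<open>id_part k\<close>, \<open>q\<close> and \<open>p\<close>, cleared of the terms that
cancel.\<close>

lemma nc_pjoin_triangle:
  assumes p: "p \<in> Part k" and q: "q \<in> Part k"
  shows "nc (pjoin k q (id_part k)) + nc (pjoin k q p) \<le> nc q + nc (pjoin k p (id_part k))"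
proof -
  have "(2::nat) ^ (nc (pjoin k q (id_part k)) + nc (pjoin k q p))
      \<le> 2 ^ (nc q + nc (pjoin k p (id_part k)))"
    using card_block_maps_modular[of "points k" q "id_part k" p] p q id_part_in_Part[of k]
    by (simp add: Part_def partition_on_def card_block_maps_join card_block_maps_Part power_add)
  then show ?thesis by simp
qed

lemma ple_iff:
  "ple k q p \<longleftrightarrow> nc (pjoin k q (id_part k)) + nc (pjoin k q p) = nc q + nc (pjoin k p (id_part k))"
proof -
  have *: "(a + b) / 2 - x + ((b + c) / 2 - y) = (a + c) / 2 - z \<longleftrightarrow> x + y = b + z"
    for a b c x y z :: real by (auto simp: field_simps)
  show ?thesis
    unfolding ple_def pdist_def pjoin_commute[of k "id_part k" p] pjoin_commute[of k "id_part k" q] *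
    by linarith
qed

section \<open>Restricting and relabelling partitions\<close>

text \<open>Restriction without the relabelling that \<open>prestrict\<close> performs. The recursions below stay inside a fixed
set of labels and are therefore stated with it.\<close>

definition blocks_within :: "diagram \<Rightarrow> nat set \<Rightarrow> diagram" where
  "blocks_within p I = {B \<inter> (I <+> I) | B. B \<in> p} - {{}}"

definition splits_along :: "diagram \<Rightarrow> nat set \<Rightarrow> bool" where
  "splits_along q I \<longleftrightarrow> (\<forall>B\<in>q. B \<subseteq> I <+> I \<or> B \<inter> (I <+> I) = {})"

lemma prestrict_eq: "prestrict p I = perm_act (rank_in I) (blocks_within p I)"
  by (simp add: prestrict_def perm_act_def blocks_within_def)

lemma partition_on_blocks_within:
  assumes "partition_on (S <+> S) q" and I: "I \<subseteq> S"
  shows "partition_on (I <+> I) (blocks_within q I)"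
proof -
  have "(\<inter>) (I <+> I) ` q - {{}} = blocks_within q I"
    unfolding blocks_within_def by (auto simp: Int_commute)
  moreover have "(I <+> I) \<inter> (S <+> S) = I <+> I" using I by auto
  ultimately show ?thesis using partition_on_restrict[OF assms(1), of "I <+> I"] by simp
qed

lemma rank_in_less: "finite S \<Longrightarrow> j \<in> S \<Longrightarrow> i < j \<Longrightarrow> rank_in S i < rank_in S j"
  unfolding rank_in_def by (intro psubset_card_mono psubsetI) (auto, metis (mono_tags, lifting) mem_Collect_eq linorder_not_le order_refl)

lemma inj_on_rank_in: "finite S \<Longrightarrow> inj_on (rank_in S) S"
  by (rule linorder_inj_onI) (metis rank_in_less less_irrefl, linarith)

lemma bij_betw_rank_in:
  assumes S: "finite S"
  shows "bij_betw (rank_in S) S {1..card S}"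
proof -
  have "rank_in S i \<in> {1..card S}" if "i \<in> S" for i
  proof -
    have "{j \<in> S. j \<le> i} \<noteq> {}" using that by auto
    then have "0 < rank_in S i" using S by (auto simp: rank_in_def card_gt_0_iff)
    moreover have "rank_in S i \<le> card S" unfolding rank_in_def using S by (intro card_mono) auto
    ultimately show ?thesis by auto
  qed
  then have "rank_in S ` S \<subseteq> {1..card S}" by auto
  then have "rank_in S ` S = {1..card S}"
    using inj_on_rank_in[OF S] by (intro card_subset_eq) (auto simp: card_image)
  then show ?thesis using inj_on_rank_in[OF S] by (simp add: bij_betw_def)
qed

lemma rank_in_le_iff: "finite S \<Longrightarrow> i \<in> S \<Longrightarrow> j \<in> S \<Longrightarrow> rank_in S i \<le> rank_in S j \<longleftrightarrow> i \<le> j"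
  by (metis linorder_not_le nle_le rank_in_less)

lemma rank_in_rank_in:
  assumes S: "finite S" and I: "I \<subseteq> S" and i: "i \<in> I"
  shows "rank_in (rank_in S ` I) (rank_in S i) = rank_in I i"
proof -
  have "{j \<in> rank_in S ` I. j \<le> rank_in S i} = rank_in S ` {x \<in> I. x \<le> i}"
    using rank_in_le_iff[OF S] I i by auto
  moreover have "inj_on (rank_in S) {x \<in> I. x \<le> i}"
    by (rule inj_on_subset[OF inj_on_rank_in[OF S]]) (use I in auto)
  ultimately have "card {j \<in> rank_in S ` I. j \<le> rank_in S i} = card {x \<in> I. x \<le> i}"
    by (simp only: card_image)
  then show ?thesis by (simp only: rank_in_def[of "rank_in S ` I"] rank_in_def[of I])
qed

lemma rank_in_atLeastAtMost: "i \<in> {1..k} \<Longrightarrow> rank_in {1..k} i = i"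
proof -
  assume "i \<in> {1..k}"
  then have "{j \<in> {1..k}. j \<le> i} = {1..i}" by auto
  then show ?thesis by (simp add: rank_in_def)
qed

lemma inj_on_map_sum_Plus: "inj_on f S \<Longrightarrow> inj_on (map_sum f f) (S <+> S)"
  by (intro inj_onI) (auto elim!: PlusE dest: inj_onD)

lemma map_sum_image_Plus: "map_sum f f ` (S <+> S) = f ` S <+> f ` S"
  unfolding Plus_def image_Un image_image by simp

lemma perm_act_comp:
  "(\<And>x. x \<in> S \<Longrightarrow> g (f x) = h x) \<Longrightarrow> \<Union>q \<subseteq> S <+> S \<Longrightarrow> perm_act g (perm_act f q) = perm_act h q"
  unfolding perm_act_def image_image
  by (intro image_cong refl) (auto simp: map_sum.compositionality)

lemma perm_act_ident:
  assumes "\<And>x. x \<in> S \<Longrightarrow> f x = x" "\<Union>q \<subseteq> S <+> S"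
  shows "perm_act f q = q"
proof -
  have *: "map_sum f f x = x" if "x \<in> S <+> S" for x using that assms(1) by auto
  have "map_sum f f ` B = B" if "B \<in> q" for B
  proof -
    have "map_sum f f ` B = (\<lambda>x. x) ` B"
      using that assms(2) * by (intro image_cong) auto
    then show ?thesis by simp
  qed
  then show ?thesis by (simp add: perm_act_def)
qed

lemma nc_perm_act:
  assumes "inj_on f S" "\<Union>q \<subseteq> S <+> S"
  shows "nc (perm_act f q) = nc q"
proof -
  have "inj_on ((`) (map_sum f f)) (Pow (S <+> S))"
    using inj_on_map_sum_Plus[OF assms(1)] by (rule inj_on_image_Pow)
  then have "inj_on ((`) (map_sum f f)) q"
    by (rule inj_on_subset) (use assms(2) in auto)
  then show ?thesis by (simp add: nc_def perm_act_def card_image)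
qed

lemma bij_betw_map_sum_Plus:
  "bij_betw h S T \<Longrightarrow> bij_betw (map_sum h h) (S <+> S) (T <+> T)"
  by (simp add: bij_betw_def inj_on_map_sum_Plus map_sum_image_Plus)

lemma perm_act_partition:
  assumes "partition_on (S <+> S) q" "bij_betw h S T"
  shows "partition_on (T <+> T) (perm_act h q)"
proof -
  have inj: "inj_on h S" and img: "h ` S = T" using assms(2) by (auto simp: bij_betw_def)
  have "partition_on (map_sum h h ` (S <+> S)) ((`) (map_sum h h) ` q - {{}})"
    by (rule partition_on_inj_image[OF assms(1) inj_on_map_sum_Plus[OF inj]])
  moreover have "{} \<notin> (`) (map_sum h h) ` q"
    using partition_onD3[OF assms(1)] by auto
  ultimately show ?thesis by (simp add: perm_act_def map_sum_image_Plus img)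
qed

text \<open>Restricting twice and relabelling after each restriction has the same effect as one restriction,
because ranks inside a subset can be computed from ranks inside the larger set.\<close>

lemma prestrict_perm_act:
  assumes S: "finite S" and q: "\<Union>q \<subseteq> S <+> S" and I: "I \<subseteq> S"
  shows "prestrict (perm_act (rank_in S) q) (rank_in S ` I) = prestrict q I"
proof -
  let ?r = "rank_in S" and ?R = "map_sum (rank_in S) (rank_in S)"
  have inj: "inj_on ?R (S <+> S)"
    by (rule inj_on_map_sum_Plus[OF inj_on_rank_in[OF S]])
  have *: "?R ` B \<inter> (?r ` I <+> ?r ` I) = ?R ` (B \<inter> (I <+> I))" if "B \<in> q" for B
  proof -
    have "B \<subseteq> S <+> S" "I <+> I \<subseteq> S <+> S" using that q I by auto
    from inj_on_image_Int[OF inj this] show ?thesis by (simp add: map_sum_image_Plus)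
  qed
  have "blocks_within (perm_act ?r q) (?r ` I) = perm_act ?r (blocks_within q I)"
  proof -
    have "blocks_within (perm_act ?r q) (?r ` I) = (\<lambda>B. ?R ` B \<inter> (?r ` I <+> ?r ` I)) ` q - {{}}"
      by (auto simp: blocks_within_def perm_act_def)
    also have "\<dots> = (\<lambda>B. ?R ` (B \<inter> (I <+> I))) ` q - {{}}"
      using * by simp
    also have "\<dots> = perm_act ?r (blocks_within q I)"
      by (auto simp: blocks_within_def perm_act_def)
    finally show ?thesis .
  qed
  then show ?thesis
    unfolding prestrict_eq
    using perm_act_comp[of I "rank_in (?r ` I)" ?r "rank_in I" "blocks_within q I"] rank_in_rank_in[OF S I]
    by (auto simp: blocks_within_def)
qed

lemma nc_prestrict:
  assumes q: "partition_on (S <+> S) q" and S: "finite S" and I: "I \<subseteq> S"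
  shows "nc (prestrict q I) = card {B \<in> q. B \<inter> (I <+> I) \<noteq> {}}"
proof -
  have "finite I" using S I finite_subset by auto
  then have "nc (prestrict q I) = nc (blocks_within q I)"
    unfolding prestrict_eq by (intro nc_perm_act[OF inj_on_rank_in]) (auto simp: blocks_within_def)
  also have "blocks_within q I = (\<lambda>B. B \<inter> (I <+> I)) ` {B \<in> q. B \<inter> (I <+> I) \<noteq> {}}"
    by (auto simp: blocks_within_def)
  also have "nc \<dots> = card {B \<in> q. B \<inter> (I <+> I) \<noteq> {}}"
    unfolding nc_def
  proof (rule card_image, rule inj_onI)
    fix B B' assume B: "B \<in> {B \<in> q. B \<inter> (I <+> I) \<noteq> {}}" "B' \<in> {B \<in> q. B \<inter> (I <+> I) \<noteq> {}}"
      "B \<inter> (I <+> I) = B' \<inter> (I <+> I)"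
    then have "B \<inter> B' \<noteq> {}" by blast
    moreover have "disjoint q" using q by (rule partition_onD2)
    ultimately show "B = B'" using B(1,2) disjointD[of q B B'] by blast
  qed
  finally show ?thesis .
qed

text \<open>The blocks that meet \<open>I\<close> and those that meet its complement cover \<open>q\<close>, and a block is counted twice
exactly if it meets both. This turns the condition in the definition of \<open>boxplus\<close> into a statement
about single blocks.\<close>

lemma nc_prestrict_splits_along:
  assumes q: "partition_on (S <+> S) q" and S: "finite S" and I: "I \<subseteq> S"
  shows "nc (prestrict q I) + nc (prestrict q (S - I)) = nc q \<longleftrightarrow> splits_along q I"
proof -
  let ?a = "{B \<in> q. B \<inter> (I <+> I) \<noteq> {}}" and ?b = "{B \<in> q. B \<inter> ((S - I) <+> (S - I)) \<noteq> {}}"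
  have fin: "finite q" using q S finite_elements[of "S <+> S" q] by auto
  have BS: "B \<subseteq> S <+> S" "B \<noteq> {}" if "B \<in> q" for B using that q by (auto simp: partition_on_def)
  have pts: "S <+> S = (I <+> I) \<union> ((S - I) <+> (S - I))" "(I <+> I) \<inter> ((S - I) <+> (S - I)) = {}"
    using I by auto
  have sub: "B \<subseteq> (I <+> I) \<union> ((S - I) <+> (S - I))" if "B \<in> q" for B
    using BS(1)[OF that] unfolding pts(1) .
  have "B \<inter> (I <+> I) \<noteq> {} \<or> B \<inter> ((S - I) <+> (S - I)) \<noteq> {}" if "B \<in> q" for B
    using sub[OF that] BS(2)[OF that] by blast
  then have "?a \<union> ?b = q" by blast
  then have "card ?a + card ?b = card q + card (?a \<inter> ?b)"
    using card_Un_Int[of ?a ?b] fin by simp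
  then have "nc (prestrict q I) + nc (prestrict q (S - I)) = nc q \<longleftrightarrow> ?a \<inter> ?b = {}"
    using nc_prestrict[OF q S] I fin by (simp add: nc_def)
  also have "?a \<inter> ?b = {} \<longleftrightarrow> splits_along q I"
  proof -
    have *: "B \<subseteq> I <+> I \<longleftrightarrow> B \<inter> ((S - I) <+> (S - I)) = {}" if "B \<in> q" for B
      using sub[OF that] pts(2) by blast
    have "{B \<in> q. \<not> P B} \<inter> {B \<in> q. \<not> R B} = {} \<longleftrightarrow> (\<forall>B\<in>q. R B \<or> P B)" for P R
      by blast
    from this[of "\<lambda>B. B \<inter> (I <+> I) = {}" "\<lambda>B. B \<inter> ((S - I) <+> (S - I)) = {}"]
    show ?thesis unfolding splits_along_def by (simp only: * cong: ball_cong)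
  qed
  finally show ?thesis .
qed

section \<open>Powers of a form that lives on pairs\<close>

text \<open>The \<open>n\<close>-th power evaluated at a partition whose labels form an arbitrary finite set \<open>S\<close> instead of
an initial segment. This makes it possible to iterate the removal of a pair of labels.\<close>

definition boxpower_on :: "(diagram \<Rightarrow> complex) \<Rightarrow> nat \<Rightarrow> nat set \<Rightarrow> diagram \<Rightarrow> complex" where
  "boxpower_on \<phi> n S q = boxpower (extend2 \<phi>) n (card S) (perm_act (rank_in S) q)"

lemma boxpower_on_0: "boxpower_on \<phi> 0 S q = (if q = {} then 1 else 0)"
  by (simp add: boxpower_on_def boxpower_def boxunit_def perm_act_def)

text \<open>Since the form is supported on partitions with two labels, one factor of the power takes away one
pair \<open>I\<close> of labels; the condition in \<open>boxplus\<close> says that no block of \<open>q\<close> connects \<open>I\<close> with the rest.\<close>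

lemma boxpower_on_Suc:
  assumes q: "partition_on (S <+> S) q" and S: "finite S"
  shows "boxpower_on \<phi> (Suc n) S q =
    (\<Sum>I | I \<subseteq> S \<and> card I = 2 \<and> splits_along q I. \<phi> (prestrict q I) * boxpower_on \<phi> n (S - I) (blocks_within q (S - I)))"
proof -
  let ?r = "rank_in S" and ?p = "perm_act (rank_in S) q" and ?k = "card S"
  let ?T = "{J. J \<subseteq> {1..?k} \<and> nc (prestrict ?p J) + nc (prestrict ?p ({1..?k} - J)) = nc ?p}"
  let ?f = "\<lambda>J. extend2 \<phi> (card J) (prestrict ?p J) *
       boxpower (extend2 \<phi>) n (card ({1..?k} - J)) (prestrict ?p ({1..?k} - J))"
  have r: "bij_betw ?r S {1..?k}" by (rule bij_betw_rank_in[OF S])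
  then have inj: "inj_on ?r S" and img: "?r ` S = {1..?k}" by (auto simp: bij_betw_def)
  have qS: "\<Union>q \<subseteq> S <+> S" using q by (auto simp: partition_on_def)
  have compl: "{1..?k} - ?r ` I = ?r ` (S - I)" if "I \<subseteq> S" for I
    using inj_on_image_set_diff[OF inj, of S I] that img by auto
  have cond: "?r ` I \<in> ?T \<longleftrightarrow> splits_along q I" if "I \<subseteq> S" for I
    using that nc_prestrict_splits_along[OF q S that] nc_perm_act[OF inj qS] img
      prestrict_perm_act[OF S qS that] prestrict_perm_act[OF S qS, of "S - I"] compl[OF that]
    by auto
  have cardr: "card (?r ` I) = card I" if "I \<subseteq> S" for I
    using inj_on_subset[OF inj that] by (simp add: card_image)
  have "boxpower_on \<phi> (Suc n) S q = (\<Sum>J\<in>?T. ?f J)"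
    by (simp add: boxpower_on_def boxpower_def boxplus_def)
  also have "\<dots> = (\<Sum>J\<in>{J\<in>?T. card J = 2}. ?f J)"
    by (rule sum.mono_neutral_right) (auto simp: extend2_def)
  also have "\<dots> = (\<Sum>I | I \<subseteq> S \<and> card I = 2 \<and> splits_along q I. ?f (?r ` I))"
  proof (rule sum.reindex_bij_betw[symmetric])
    have "bij_betw ((`) ?r) (Pow S) (Pow {1..?k})" using r by (rule bij_betw_Pow)
    then have "bij_betw ((`) ?r) {I. I \<subseteq> S \<and> card I = 2 \<and> splits_along q I} ((`) ?r ` {I. I \<subseteq> S \<and> card I = 2 \<and> splits_along q I})"
      by (rule bij_betw_subset) auto
    moreover have "(`) ?r ` {I. I \<subseteq> S \<and> card I = 2 \<and> splits_along q I} = {J\<in>?T. card J = 2}"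
    proof (intro equalityI subsetI)
      fix J assume "J \<in> (`) ?r ` {I. I \<subseteq> S \<and> card I = 2 \<and> splits_along q I}"
      then obtain I where I: "J = ?r ` I" "I \<subseteq> S" "card I = 2" "splits_along q I" by auto
      have "J \<in> ?T" unfolding I(1) cond[OF I(2)] by (rule I(4))
      moreover have "card J = 2" unfolding I(1) cardr[OF I(2)] by (rule I(3))
      ultimately show "J \<in> {J\<in>?T. card J = 2}" by simp
    next
      fix J assume J: "J \<in> {J\<in>?T. card J = 2}"
      then have J1: "J \<in> ?T" and J2: "card J = 2" by blast+
      from J1 have "J \<subseteq> ?r ` S" using img by blast
      then obtain I where I: "I \<subseteq> S" "J = ?r ` I" by (auto simp: subset_image_iff)
      then show "J \<in> (`) ?r ` {I. I \<subseteq> S \<and> card I = 2 \<and> splits_along q I}"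
        using J1 J2 I(1) unfolding I(2) cond[OF I(1)] cardr[OF I(1)] by blast
    qed
    ultimately show "bij_betw ((`) ?r) {I. I \<subseteq> S \<and> card I = 2 \<and> splits_along q I} {J\<in>?T. card J = 2}"
      by simp
  qed
  also have "\<dots> = (\<Sum>I | I \<subseteq> S \<and> card I = 2 \<and> splits_along q I. \<phi> (prestrict q I) * boxpower_on \<phi> n (S - I) (blocks_within q (S - I)))"
  proof (rule sum.cong[OF refl], clarify)
    fix I assume I: "I \<subseteq> S" "card I = 2"
    show "?f (?r ` I) = \<phi> (prestrict q I) * boxpower_on \<phi> n (S - I) (blocks_within q (S - I))"
      unfolding compl[OF I(1)] cardr[OF I(1)] cardr[OF Diff_subset]
        prestrict_perm_act[OF S qS I(1)] prestrict_perm_act[OF S qS Diff_subset]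
      by (simp add: extend2_def I boxpower_on_def prestrict_eq)
  qed
  finally show ?thesis .
qed

lemma partition_on_empty_iff: "partition_on A {} \<longleftrightarrow> A = {}"
  by (auto simp: partition_on_def)

lemma boxpower_on_eq_0:
  assumes "partition_on (S <+> S) q" "finite S" "card S \<noteq> 2 * n"
  shows "boxpower_on \<phi> n S q = 0"
  using assms
proof (induction n arbitrary: S q)
  case 0
  then show ?case by (auto simp: boxpower_on_0 partition_on_empty_iff)
next
  case (Suc n)
  have "boxpower_on \<phi> n (S - I) (blocks_within q (S - I)) = 0" if "I \<subseteq> S" "card I = 2" for I
  proof (rule Suc.IH)
    show "partition_on ((S - I) <+> (S - I)) (blocks_within q (S - I))"
      by (rule partition_on_blocks_within[OF Suc.prems(1)]) auto
    have "card S = card (S - I) + 2"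
      using that Suc.prems(2) card_mono[of S I] by (simp add: card_Diff_subset finite_subset)
    then show "card (S - I) \<noteq> 2 * n" using Suc.prems(3) by simp
  qed (use Suc.prems in auto)
  then show ?case by (simp add: boxpower_on_Suc[OF Suc.prems(1,2)])
qed

lemma prestrict_in_Part:
  assumes q: "partition_on (S <+> S) q" and S: "finite S" and I: "I \<subseteq> S"
  shows "prestrict q I \<in> Part (card I)"
proof -
  have "finite I" using S I finite_subset by auto
  from perm_act_partition[OF partition_on_blocks_within[OF q I] bij_betw_rank_in[OF this]]
  show ?thesis by (simp add: Part_def points_def prestrict_eq)
qed

lemma boxpower_on_cong:
  assumes "partition_on (S <+> S) q" "finite S" and \<phi>: "\<And>p. p \<in> Part 2 \<Longrightarrow> \<phi> p = \<phi>' p"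
  shows "boxpower_on \<phi> n S q = boxpower_on \<phi>' n S q"
  using assms(1,2)
proof (induction n arbitrary: S q)
  case 0
  then show ?case by (simp add: boxpower_on_0)
next
  case (Suc n)
  show ?case
    unfolding boxpower_on_Suc[OF Suc.prems]
  proof (rule sum.cong[OF refl], clarify)
    fix I assume I: "I \<subseteq> S" "card I = 2"
    have "boxpower_on \<phi> n (S - I) (blocks_within q (S - I)) = boxpower_on \<phi>' n (S - I) (blocks_within q (S - I))"
      using Suc.prems by (intro Suc.IH partition_on_blocks_within[OF Suc.prems(1)]) auto
    moreover have "\<phi> (prestrict q I) = \<phi>' (prestrict q I)"
      using prestrict_in_Part[OF Suc.prems I(1)] I(2) by (intro \<phi>) simp
    ultimately show "\<phi> (prestrict q I) * boxpower_on \<phi> n (S - I) (blocks_within q (S - I)) =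
      \<phi>' (prestrict q I) * boxpower_on \<phi>' n (S - I) (blocks_within q (S - I))" by simp
  qed
qed

lemma perm_act_rank_in_id: "p \<in> Part k \<Longrightarrow> perm_act (rank_in {1..k}) p = p"
  using perm_act_ident[of "{1..k}" "rank_in {1..k}" p, OF rank_in_atLeastAtMost]
  by (simp add: Part_def partition_on_def points_def)

lemma blocks_within_inside:
  assumes "\<And>B. B \<in> q \<Longrightarrow> B \<subseteq> I <+> I" "{} \<notin> q"
  shows "blocks_within q I = q"
proof -
  have "(\<lambda>B. B \<inter> (I <+> I)) ` q = q"
    using assms(1) by (auto simp: image_iff Int_absorb2)
  moreover have "blocks_within q I = (\<lambda>B. B \<inter> (I <+> I)) ` q - {{}}" by (auto simp: blocks_within_def)
  ultimately show ?thesis using assms(2) by simp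
qed

lemma prestrict_full: "p \<in> Part k \<Longrightarrow> prestrict p {1..k} = p"
proof -
  assume p: "p \<in> Part k"
  then have "partition_on ({1..k} <+> {1..k}) p" by (simp add: Part_def points_def)
  then have "blocks_within p {1..k} = p"
    by (intro blocks_within_inside) (auto simp: partition_on_def)
  then show ?thesis using perm_act_rank_in_id[OF p] by (simp add: prestrict_eq)
qed

text \<open>Only one term of the exponential series survives, because each factor uses up exactly two labels.
For odd \<open>k\<close> the term on the right vanishes as well.\<close>

lemma boxexp_eq_boxpower_on:
  assumes p: "p \<in> Part k"
  shows "boxexp (extend2 \<phi>) k p = boxpower_on \<phi> (k div 2) {1..k} p / fact (k div 2)"
proof -
  have pk: "partition_on ({1..k} <+> {1..k}) p" using p by (simp add: Part_def points_def)
  have bp: "boxpower (extend2 \<phi>) n k p = boxpower_on \<phi> n {1..k} p" for n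
    by (simp add: boxpower_on_def perm_act_rank_in_id[OF p, simplified])
  have "boxpower (extend2 \<phi>) n k p / fact n = 0" if "n \<notin> {k div 2}" for n
    using boxpower_on_eq_0[OF pk, of n] that by (auto simp: bp)
  from suminf_finite[OF _ this, of "{k div 2}"] show ?thesis
    unfolding boxexp_def by (simp add: bp)
qed

lemma boxexp_cong:
  assumes p: "p \<in> Part k" and \<phi>: "\<And>p. p \<in> Part 2 \<Longrightarrow> \<phi> p = \<phi>' p"
  shows "boxexp (extend2 \<phi>) k p = boxexp (extend2 \<phi>') k p"
  unfolding boxexp_eq_boxpower_on[OF p]
  using p boxpower_on_cong[of "{1..k}" p \<phi> \<phi>'] \<phi> by (simp add: Part_def points_def)

lemma boxexp_2:
  assumes p: "p \<in> Part 2"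
  shows "boxexp (extend2 \<phi>) 2 p = \<phi> p"
proof -
  have pk: "partition_on ({1..2::nat} <+> {1..2}) p" using p by (simp add: Part_def points_def)
  have BS: "B \<subseteq> {1..2} <+> {1..2}" if "B \<in> p" for B using that pk by (auto simp: partition_on_def)
  have "I = {1..2}" if "I \<subseteq> {1..2::nat}" "card I = 2" for I
    using that card_subset_eq[of "{1..2::nat}" I] by simp
  then have "{I. I \<subseteq> {1..2::nat} \<and> card I = 2 \<and> splits_along p I} = {{1..2}}"
    using BS by (auto simp: splits_along_def)
  moreover have "prestrict p {1..2} = p" by (rule prestrict_full[OF p])
  moreover have "blocks_within p {} = {}" by (auto simp: blocks_within_def)
  ultimately have "boxpower_on \<phi> (Suc 0) {1..2} p = \<phi> p"
    unfolding boxpower_on_Suc[OF pk finite_atLeastAtMost] by (simp add: boxpower_on_0)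
  then show ?thesis unfolding boxexp_eq_boxpower_on[OF p] by simp
qed

section \<open>Sums over pairings as sums over partitions\<close>

definition pair_blocks :: "nat set \<Rightarrow> diagram" where
  "pair_blocks S = (\<lambda>i. {Inl i, Inr i}) ` S"

text \<open>For a partition \<open>q\<close> of the points over \<open>S\<close> this is \<open>N\<close> to the power \<open>nc (q \<or> id) - nc (q)\<close>, the
normalization of the covariance. Written with cardinalities, it makes sense for every finite set of
labels, and its multiplicativity and its invariance under relabelling follow from those of
cardinalities.\<close>

definition id_join_ratio :: "nat \<Rightarrow> nat set \<Rightarrow> diagram \<Rightarrow> real" where
  "id_join_ratio N S q = real (card (block_maps (S <+> S) {1..N} (q \<union> pair_blocks S)))
            / real (card (block_maps (S <+> S) {1..N} q))"

definition blockwise_constant :: "diagram \<Rightarrow> (nat + nat \<Rightarrow> nat) \<Rightarrow> bool" where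
  "blockwise_constant q i \<longleftrightarrow> (\<forall>B\<in>q. \<forall>a\<in>B. \<forall>b\<in>B. i a = i b)"

lemma blockwise_constant_Un: "blockwise_constant (p \<union> q) i \<longleftrightarrow> blockwise_constant p i \<and> blockwise_constant q i"
  unfolding blockwise_constant_def by (rule ball_Un)

text \<open>The sum over all ways of partitioning \<open>L\<close> into an ordered sequence of \<open>n\<close> pairs, each weighted by the
product of the values of \<open>c\<close>. It equals \<open>n!\<close> times the sum over pairings.\<close>

fun pairsum :: "(nat set \<Rightarrow> complex) \<Rightarrow> nat \<Rightarrow> nat set \<Rightarrow> complex" where
  "pairsum c 0 L = of_bool (L = {})"
| "pairsum c (Suc n) L = (\<Sum>I | I \<subseteq> L \<and> card I = 2. c I * pairsum c n (L - I))"

lemma blocks_within_Un: "blocks_within (p \<union> q) I = blocks_within p I \<union> blocks_within q I"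
  unfolding blocks_within_def by blast

lemma blocks_within_outside:
  assumes "\<And>B. B \<in> q \<Longrightarrow> B \<inter> (I <+> I) = {}"
  shows "blocks_within q I = {}"
  using assms by (auto simp: blocks_within_def)

lemma Plus_Diff:
  assumes "I \<subseteq> L"
  shows "L <+> L = (I <+> I) \<union> ((L - I) <+> (L - I))" "(I <+> I) \<inter> ((L - I) <+> (L - I)) = {}"
  using assms by auto

lemma blocks_within_split:
  assumes q: "partition_on (L <+> L) q" and I: "I \<subseteq> L" and s: "splits_along q I"
  shows "blocks_within q I \<union> blocks_within q (L - I) = q"
proof -
  let ?q1 = "{B \<in> q. B \<subseteq> I <+> I}" and ?q2 = "{B \<in> q. B \<inter> (I <+> I) = {}}"
  have q12: "q = ?q1 \<union> ?q2" using s unfolding splits_along_def by blast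
  have ne: "{} \<notin> q" using q by (rule partition_onD3)
  have BL: "B \<subseteq> (I <+> I) \<union> ((L - I) <+> (L - I))" if "B \<in> q" for B
    using that q unfolding Plus_Diff(1)[OF I, symmetric] by (auto simp: partition_on_def)
  have "blocks_within ?q1 I = ?q1" "blocks_within ?q2 (L - I) = ?q2"
    using ne BL by (intro blocks_within_inside; blast)+
  moreover have "blocks_within ?q1 (L - I) = {}" "blocks_within ?q2 I = {}"
    using Plus_Diff(2)[OF I] by (intro blocks_within_outside; blast)+
  ultimately have "blocks_within (?q1 \<union> ?q2) I \<union> blocks_within (?q1 \<union> ?q2) (L - I) = ?q1 \<union> ?q2"
    unfolding blocks_within_Un by simp
  then show ?thesis using q12 by simp
qed

lemma partition_join_blocks:
  assumes q1: "partition_on (I <+> I) q1" and q2: "partition_on ((L - I) <+> (L - I)) q2" and I: "I \<subseteq> L"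
  shows "partition_on (L <+> L) (q1 \<union> q2)" "splits_along (q1 \<union> q2) I"
    "blocks_within (q1 \<union> q2) I = q1" "blocks_within (q1 \<union> q2) (L - I) = q2"
proof -
  have B1: "B \<subseteq> I <+> I" if "B \<in> q1" for B using that q1 by (auto simp: partition_on_def)
  have B2: "B \<subseteq> (L - I) <+> (L - I)" if "B \<in> q2" for B using that q2 by (auto simp: partition_on_def)
  note dj = Plus_Diff(2)[OF I]
  have 12: "B \<inter> ((L - I) <+> (L - I)) = {}" if "B \<in> q1" for B using B1[OF that] dj by blast
  have 21: "B \<inter> (I <+> I) = {}" if "B \<in> q2" for B using B2[OF that] dj by blast
  show "partition_on (L <+> L) (q1 \<union> q2)"
  proof (rule partition_onI)
    show "\<Union>(q1 \<union> q2) = L <+> L"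
      unfolding Union_Un_distrib partition_onD1[OF q1, symmetric] partition_onD1[OF q2, symmetric]
      by (rule Plus_Diff(1)[OF I, symmetric])
    show "{} \<notin> q1 \<union> q2" using partition_onD3[OF q1] partition_onD3[OF q2] by blast
    fix B B' assume B: "B \<in> q1 \<union> q2" "B' \<in> q1 \<union> q2" "B \<noteq> B'"
    have "disjnt B B'" if "B \<in> q1" "B' \<in> q1"
      using disjointD[OF partition_onD2[OF q1] that B(3)] by (simp add: disjnt_def)
    moreover have "disjnt B B'" if "B \<in> q2" "B' \<in> q2"
      using disjointD[OF partition_onD2[OF q2] that B(3)] by (simp add: disjnt_def)
    moreover have "disjnt B B'" if "B \<in> q1" "B' \<in> q2"
      using B1[OF that(1)] B2[OF that(2)] dj unfolding disjnt_def by blast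
    moreover have "disjnt B B'" if "B \<in> q2" "B' \<in> q1"
      using B1[OF that(2)] B2[OF that(1)] dj unfolding disjnt_def by blast
    ultimately show "disjnt B B'" using B by blast
  qed
  show "splits_along (q1 \<union> q2) I" unfolding splits_along_def using B1 21 by blast
  have "blocks_within q1 I = q1" by (rule blocks_within_inside[OF _ partition_onD3[OF q1]]) (rule B1)
  moreover have "blocks_within q2 (L - I) = q2" by (rule blocks_within_inside[OF _ partition_onD3[OF q2]]) (rule B2)
  moreover have "blocks_within q1 (L - I) = {}" by (rule blocks_within_outside) (rule 12)
  moreover have "blocks_within q2 I = {}" by (rule blocks_within_outside) (rule 21)
  ultimately show "blocks_within (q1 \<union> q2) I = q1" "blocks_within (q1 \<union> q2) (L - I) = q2"
    unfolding blocks_within_Un by simp_all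
qed

lemma finite_partitions: "finite S \<Longrightarrow> finite {q. partition_on (S <+> S) q}"
  by (rule finitely_many_partition_on) simp

text \<open>A partition with no block connecting \<open>I\<close> to \<open>L - I\<close> is the same thing as a partition over \<open>I\<close>
together with one over \<open>L - I\<close>.\<close>

lemma sum_splits_along:
  fixes F :: "diagram \<Rightarrow> diagram \<Rightarrow> 'c :: comm_monoid_add"
  assumes I: "I \<subseteq> L"
  shows "(\<Sum>q | partition_on (L <+> L) q \<and> splits_along q I. F (blocks_within q I) (blocks_within q (L - I))) =
    (\<Sum>q1 | partition_on (I <+> I) q1. \<Sum>q2 | partition_on ((L - I) <+> (L - I)) q2. F q1 q2)"
  unfolding sum.cartesian_product
proof (rule sum.reindex_bij_witness[where i = "\<lambda>(q1, q2). q1 \<union> q2" and j = "\<lambda>q. (blocks_within q I, blocks_within q (L - I))"])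
  fix q assume q: "q \<in> {q. partition_on (L <+> L) q \<and> splits_along q I}"
  then show "(\<lambda>(q1, q2). q1 \<union> q2) (blocks_within q I, blocks_within q (L - I)) = q"
    using blocks_within_split[of L q I] I by simp
  show "(blocks_within q I, blocks_within q (L - I)) \<in> {q1. partition_on (I <+> I) q1} \<times> {q2. partition_on ((L - I) <+> (L - I)) q2}"
    using q partition_on_blocks_within[of L q] I by auto
next
  fix x assume "x \<in> {q1. partition_on (I <+> I) q1} \<times> {q2. partition_on ((L - I) <+> (L - I)) q2}"
  then obtain q1 q2 where x: "x = (q1, q2)" "partition_on (I <+> I) q1" "partition_on ((L - I) <+> (L - I)) q2"
    by auto
  show "(blocks_within ((\<lambda>(q1, q2). q1 \<union> q2) x) I, blocks_within ((\<lambda>(q1, q2). q1 \<union> q2) x) (L - I)) = x"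
    using partition_join_blocks[OF x(2,3) I] by (simp add: x(1))
  show "(\<lambda>(q1, q2). q1 \<union> q2) x \<in> {q. partition_on (L <+> L) q \<and> splits_along q I}"
    using partition_join_blocks[OF x(2,3) I] by (simp add: x(1))
qed simp

lemma id_join_ratio_Un:
  assumes q1: "partition_on (I <+> I) q1" and q2: "partition_on ((L - I) <+> (L - I)) q2" and I: "I \<subseteq> L"
  shows "id_join_ratio N L (q1 \<union> q2) = id_join_ratio N I q1 * id_join_ratio N (L - I) q2"
proof -
  have B1: "\<Union>q1 \<subseteq> I <+> I" using q1 by (auto simp: partition_on_def)
  have B2: "\<Union>q2 \<subseteq> (L - I) <+> (L - I)" using q2 by (auto simp: partition_on_def)
  have "pair_blocks L = pair_blocks I \<union> pair_blocks (L - I)"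
    using I unfolding pair_blocks_def by blast
  then have e: "(q1 \<union> q2) \<union> pair_blocks L = (q1 \<union> pair_blocks I) \<union> (q2 \<union> pair_blocks (L - I))"
    by (simp add: Un_ac)
  have "\<Union>(pair_blocks S) \<subseteq> S <+> S" for S by (auto simp: pair_blocks_def)
  then have B1': "\<Union>(q1 \<union> pair_blocks I) \<subseteq> I <+> I" and
      B2': "\<Union>(q2 \<union> pair_blocks (L - I)) \<subseteq> (L - I) <+> (L - I)"
    unfolding Union_Un_distrib using B1 B2 by (metis Un_least)+
  show ?thesis
    unfolding id_join_ratio_def e Plus_Diff(1)[OF I]
      card_block_maps_Un[OF Plus_Diff(2)[OF I] B1' B2'] card_block_maps_Un[OF Plus_Diff(2)[OF I] B1 B2]
    by simp
qed

text \<open>For \<open>I = {a, b}\<close> this is the prescribed value of the expectation of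
\<open>M (i (a'), i (a)) M (i (b'), i (b))\<close>.\<close>

definition pair_cov :: "(diagram \<Rightarrow> complex) \<Rightarrow> nat \<Rightarrow> (nat + nat \<Rightarrow> nat) \<Rightarrow> nat set \<Rightarrow> complex" where
  "pair_cov \<phi> N i I = (\<Sum>q | partition_on (I <+> I) q.
     \<phi> (prestrict q I) * of_real (id_join_ratio N I q) * of_bool (blockwise_constant q i))"

text \<open>Both sides satisfy the recursion that removes one pair \<open>I\<close>. On the left the pair contributes a sum
over partitions of its four points; together with a partition over \<open>L - I\<close> each of these glues to a
partition over \<open>L\<close>, and both the normalization and the condition of constancy factor accordingly.\<close>

lemma pairsum_expand:
  assumes "finite L"
  shows "pairsum (pair_cov \<phi> N i) n L =
    (\<Sum>q | partition_on (L <+> L) q. boxpower_on \<phi> n L q * of_real (id_join_ratio N L q) * of_bool (blockwise_constant q i))"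
  using assms
proof (induction n arbitrary: L)
  case 0
  let ?g = "\<lambda>q. boxpower_on \<phi> 0 L q * of_real (id_join_ratio N L q) * of_bool (blockwise_constant q i)"
  show ?case
  proof (cases "L = {}")
    case True
    have LL: "L <+> L = {}" using True by auto
    have "{q. partition_on (L <+> L) q} = {{}}" unfolding LL partition_on_empty by simp
    moreover have "id_join_ratio N {} {} = 1"
      by (simp add: id_join_ratio_def pair_blocks_def block_maps_def Plus_def)
    ultimately show ?thesis using True by (simp add: boxpower_on_0 blockwise_constant_def)
  next
    case False
    then have "?g q = 0" if "q \<in> {q. partition_on (L <+> L) q}" for q
      using that by (auto simp: boxpower_on_0 partition_on_empty_iff)
    then have "sum ?g {q. partition_on (L <+> L) q} = 0" by (intro sum.neutral ballI)
    then show ?thesis using False by simp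
  qed
next
  case (Suc n)
  let ?w = "\<lambda>S q. of_real (id_join_ratio N S q) * of_bool (blockwise_constant q i) :: complex"
  let ?P = "\<lambda>S. {q. partition_on (S <+> S) q}"
  have "(\<Sum>q\<in>?P L. boxpower_on \<phi> (Suc n) L q * of_real (id_join_ratio N L q) * of_bool (blockwise_constant q i)) =
    (\<Sum>q\<in>?P L. \<Sum>I | I \<in> {I. I \<subseteq> L \<and> card I = 2} \<and> splits_along q I.
        \<phi> (prestrict q I) * boxpower_on \<phi> n (L - I) (blocks_within q (L - I)) * ?w L q)"
    using Suc.prems by (intro sum.cong refl) (simp add: boxpower_on_Suc sum_distrib_right mult.assoc conj_assoc)
  also have "\<dots> = (\<Sum>I | I \<subseteq> L \<and> card I = 2. \<Sum>q | q \<in> ?P L \<and> splits_along q I.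
        \<phi> (prestrict q I) * boxpower_on \<phi> n (L - I) (blocks_within q (L - I)) * ?w L q)"
    by (rule sum.swap_restrict) (use Suc.prems finite_partitions in auto)
  also have "\<dots> = (\<Sum>I | I \<subseteq> L \<and> card I = 2. pair_cov \<phi> N i I * pairsum (pair_cov \<phi> N i) n (L - I))"
  proof (rule sum.cong[OF refl], clarify)
    fix I assume I: "I \<subseteq> L" "card I = 2"
    define F where "F q1 q2 = (\<phi> (prestrict q1 I) * ?w I q1) * (boxpower_on \<phi> n (L - I) q2 * ?w (L - I) q2)"
      for q1 q2
    have "(\<Sum>q | q \<in> ?P L \<and> splits_along q I. \<phi> (prestrict q I) * boxpower_on \<phi> n (L - I) (blocks_within q (L - I)) * ?w L q) =
      (\<Sum>q | partition_on (L <+> L) q \<and> splits_along q I. F (blocks_within q I) (blocks_within q (L - I)))"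
    proof (rule sum.cong)
      fix q assume "q \<in> {q. partition_on (L <+> L) q \<and> splits_along q I}"
      then have q: "partition_on (L <+> L) q" "splits_along q I" by auto
      define q1 q2 where q12: "q1 = blocks_within q I" "q2 = blocks_within q (L - I)"
      have p1: "partition_on (I <+> I) q1" and p2: "partition_on ((L - I) <+> (L - I)) q2"
        unfolding q12 using q(1) I(1) by (auto intro: partition_on_blocks_within)
      have qe: "q = q1 \<union> q2" unfolding q12 using blocks_within_split[OF q(1) I(1) q(2)] by simp
      have "blocks_within q1 I = q1"
        using p1 by (intro blocks_within_inside) (auto simp: partition_on_def)
      then have "prestrict q I = prestrict q1 I" by (simp add: prestrict_eq q12)
      then show "\<phi> (prestrict q I) * boxpower_on \<phi> n (L - I) (blocks_within q (L - I)) * ?w L q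
          = F (blocks_within q I) (blocks_within q (L - I))"
        unfolding F_def q12[symmetric] by (simp add: qe id_join_ratio_Un[OF p1 p2 I(1)] blockwise_constant_Un)
    qed auto
    also have "\<dots> = (\<Sum>q1\<in>?P I. \<Sum>q2\<in>?P (L - I). F q1 q2)"
      by (rule sum_splits_along[OF I(1)])
    also have "\<dots> = (\<Sum>q1\<in>?P I. \<phi> (prestrict q1 I) * ?w I q1) *
       (\<Sum>q2\<in>?P (L - I). boxpower_on \<phi> n (L - I) q2 * ?w (L - I) q2)"
      unfolding F_def sum_product ..
    also have "\<dots> = pair_cov \<phi> N i I * pairsum (pair_cov \<phi> N i) n (L - I)"
      using Suc.IH[of "L - I"] Suc.prems
      by (simp add: pair_cov_def[of \<phi> N i I] mult.assoc)
    finally show "(\<Sum>q | q \<in> ?P L \<and> splits_along q I. \<phi> (prestrict q I) * boxpower_on \<phi> n (L - I) (blocks_within q (L - I)) * ?w L q)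
      = pair_cov \<phi> N i I * pairsum (pair_cov \<phi> N i) n (L - I)" .
  qed
  finally show ?case by simp
qed

section \<open>Moments of linear forms in normal variables\<close>

abbreviation std_normal :: "real measure" where
  "std_normal \<equiv> density lborel (\<lambda>x. ennreal (std_normal_density x))"

definition gauss_space :: "(nat \<Rightarrow> real) measure" where
  "gauss_space = PiM UNIV (\<lambda>_. std_normal)"

definition normal_moment :: "nat \<Rightarrow> real" where
  "normal_moment n = (\<integral>x. x ^ n \<partial>std_normal)"

lemma prob_space_std_normal: "prob_space std_normal"
  by (rule prob_space_normal_density) simp

interpretation gs: product_prob_space "\<lambda>_ :: nat. std_normal" UNIV
  using prob_space_std_normal
  by (simp add: product_prob_space_def product_prob_space_axioms_def product_sigma_finite_def
      prob_space_imp_sigma_finite)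

lemma prob_space_gauss_space: "prob_space gauss_space"
  unfolding gauss_space_def by (rule gs.P.prob_space_axioms)

lemma integrable_normal_moment: "integrable std_normal (\<lambda>x. x ^ n)"
  using integrable_std_normal_moment[of n] by (subst integrable_density) auto

lemma normal_moment_eq: "normal_moment n = (\<integral>x. std_normal_density x * x ^ n \<partial>lborel)"
  unfolding normal_moment_def by (subst integral_density) auto

lemma normal_moment_even: "normal_moment (2 * k) = fact (2 * k) / (2 ^ k * fact k)"
  unfolding normal_moment_eq by (rule integral_std_normal_moment_even)

lemma normal_moment_odd: "normal_moment (2 * k + 1) = 0"
  unfolding normal_moment_eq by (rule integral_std_normal_moment_odd)

lemma normal_moment_rec: "normal_moment (Suc (Suc n)) = real (Suc n) * normal_moment n"
proof (cases "even n")
  case True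
  then obtain k where n: "n = 2 * k" by auto
  \<comment> \<open>the common factor \<open>2 k + 2\<close> is split off so that it cancels\<close>
  have "normal_moment (2 * Suc k) = (2 * real (Suc k)) * (real (2 * k + 1) * fact (2 * k)) / ((2 * real (Suc k)) * (2 ^ k * fact k))"
    unfolding normal_moment_even by (simp add: algebra_simps)
  also have "\<dots> = real (2 * k + 1) * normal_moment (2 * k)"
    unfolding normal_moment_even by (subst mult_divide_mult_cancel_left) auto
  finally show ?thesis using n by simp
next
  case False
  then obtain k where n: "n = 2 * k + 1" by (auto elim: oddE)
  show ?thesis using normal_moment_odd[of "Suc k"] normal_moment_odd[of k] n by simp
qed

text \<open>The form in which the recursion of the normal moments is needed: the binomial coefficient counts the
pairs that can be removed from \<open>c\<close> equal indices.\<close>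

lemma normal_moment_choose: "real (c choose 2) * normal_moment (c - 2) = real c / 2 * normal_moment c"
proof (cases "c < 2")
  case True
  then have "c = 0 \<or> c = 1" by auto
  then show ?thesis using normal_moment_odd[of 0] by auto
next
  case False
  then obtain n where c: "c = Suc (Suc n)" by (metis add_2_eq_Suc le_Suc_ex not_less)
  have "real (c choose 2) = real c * real (Suc n) / 2"
    unfolding c choose_two by (subst real_of_nat_div) (auto simp: algebra_simps)
  then show ?thesis by (simp add: c normal_moment_rec)
qed

text \<open>Only the coordinates in \<open>J\<close> matter, and the law of these is a finite product measure.\<close>

lemma gauss_space_prod:
  assumes J: "finite J" and f: "\<And>j. j \<in> J \<Longrightarrow> integrable std_normal (f j :: real \<Rightarrow> real)"
  shows "integrable gauss_space (\<lambda>\<omega>. \<Prod>j\<in>J. f j (\<omega> j))"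
    and "(\<integral>\<omega>. (\<Prod>j\<in>J. f j (\<omega> j)) \<partial>gauss_space) = (\<Prod>j\<in>J. integral\<^sup>L std_normal (f j))"
proof -
  let ?P = "PiM J (\<lambda>_. std_normal)" and ?g = "\<lambda>x. \<Prod>j\<in>J. f j (x j)"
  have d: "distr gauss_space ?P (\<lambda>x. restrict x J) = ?P"
    unfolding gauss_space_def using J by (intro gs.distr_PiM_restrict_finite) auto
  have r: "(\<lambda>x. restrict x J) \<in> measurable gauss_space ?P"
    unfolding gauss_space_def by (rule measurable_restrict_subset) simp
  have int: "integrable ?P ?g" by (rule gs.product_integrable_prod[OF J f])
  have e: "?g (restrict x J) = ?g x" for x by (intro prod.cong) auto
  show "integrable gauss_space ?g"
    using integrable_distr[OF r, of ?g] int by (simp add: d e)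
  have "integral\<^sup>L gauss_space ?g = integral\<^sup>L (distr gauss_space ?P (\<lambda>x. restrict x J)) ?g"
    using integral_distr[OF r borel_measurable_integrable[OF int]] by (simp add: e)
  also have "\<dots> = (\<Prod>j\<in>J. integral\<^sup>L std_normal (f j))"
    unfolding d by (rule gs.product_integral_prod[OF J f])
  finally show "integral\<^sup>L gauss_space ?g = (\<Prod>j\<in>J. integral\<^sup>L std_normal (f j))" .
qed

text \<open>By independence, the expectation of the product of the coordinates \<open>f (l)\<close> for \<open>l \<in> L\<close>,
when \<open>f\<close> maps \<open>L\<close> into \<open>J\<close>.\<close>

definition fibre_moment :: "nat set \<Rightarrow> (nat \<Rightarrow> nat) \<Rightarrow> nat set \<Rightarrow> real" where
  "fibre_moment J f L = (\<Prod>j\<in>J. normal_moment (card {l\<in>L. f l = j}))"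

lemma gauss_space_moment:
  assumes L: "finite L" and J: "finite J" and f: "f ` L \<subseteq> J"
  shows "integrable gauss_space (\<lambda>\<omega>. \<Prod>l\<in>L. \<omega> (f l))"
    and "(\<integral>\<omega>. (\<Prod>l\<in>L. \<omega> (f l)) \<partial>gauss_space) = fibre_moment J f L"
proof -
  have e: "(\<Prod>l\<in>L. \<omega> (f l)) = (\<Prod>j\<in>J. \<omega> j ^ card {l\<in>L. f l = j})" for \<omega> :: "nat \<Rightarrow> real"
    using prod.group[OF L J f, of "\<lambda>l. \<omega> (f l)"] by simp
  show "integrable gauss_space (\<lambda>\<omega>. \<Prod>l\<in>L. \<omega> (f l))"
    unfolding e by (rule gauss_space_prod(1)[OF J integrable_normal_moment])
  show "(\<integral>\<omega>. (\<Prod>l\<in>L. \<omega> (f l)) \<partial>gauss_space) = fibre_moment J f L"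
    unfolding e fibre_moment_def gauss_space_prod(2)[OF J integrable_normal_moment] normal_moment_def ..
qed

lemma fibre_moment_cong: "(\<And>l. l \<in> L \<Longrightarrow> f l = g l) \<Longrightarrow> fibre_moment J f L = fibre_moment J g L"
  unfolding fibre_moment_def by (intro prod.cong refl arg_cong[where f = normal_moment] arg_cong[where f = card]) auto

text \<open>Wick's formula for the coordinates themselves, summed over all choices of the pair to remove. A pair
on which \<open>f\<close> is constant lies in a single fibre, so the sum decomposes over the fibres, and in a fibre of
size \<open>c\<close> it reduces to \<open>normal_moment_choose\<close>. Each fibre contributes in proportion to its size, and
the sizes add up to \<open>card L\<close>.\<close>

lemma fibre_moment_pairs:
  assumes L: "finite L" and J: "finite J" and f: "f ` L \<subseteq> J"
  shows "(\<Sum>I | I \<subseteq> L \<and> card I = 2. \<Sum>j | j \<in> J \<and> (\<forall>l\<in>I. f l = j). fibre_moment J f (L - I))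
     = real (card L) / 2 * fibre_moment J f L"
proof -
  let ?F = "\<lambda>j. {l\<in>L. f l = j}"
  let ?m = "fibre_moment J f L"
  have "(\<Sum>I | I \<subseteq> L \<and> card I = 2. \<Sum>j | j \<in> J \<and> (\<forall>l\<in>I. f l = j). fibre_moment J f (L - I))
    = (\<Sum>j\<in>J. \<Sum>I | I \<in> {I. I \<subseteq> L \<and> card I = 2} \<and> (\<forall>l\<in>I. f l = j). fibre_moment J f (L - I))"
    by (rule sum.swap_restrict) (use L J in auto)
  also have "\<dots> = (\<Sum>j\<in>J. real (card (?F j)) / 2 * ?m)"
  proof (rule sum.cong[OF refl])
    fix j assume j: "j \<in> J"
    have set_eq: "{I. I \<in> {I. I \<subseteq> L \<and> card I = 2} \<and> (\<forall>l\<in>I. f l = j)} = {I. I \<subseteq> ?F j \<and> card I = 2}"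
      by auto
    have "fibre_moment J f (L - I) = normal_moment (card (?F j) - 2) * (\<Prod>i\<in>J - {j}. normal_moment (card (?F i)))"
      if "I \<subseteq> ?F j" "card I = 2" for I
    proof -
      have "{l \<in> L - I. f l = j} = ?F j - I" by auto
      moreover have "card (?F j - I) = card (?F j) - 2"
        using that L card_Diff_subset[of I "?F j"] finite_subset[of I "?F j"] by auto
      moreover have "{l \<in> L - I. f l = i} = ?F i" if "i \<noteq> j" for i
        using that \<open>I \<subseteq> ?F j\<close> by auto
      ultimately show ?thesis
        unfolding fibre_moment_def prod.remove[OF J j]
        by simp
    qed
    then have "(\<Sum>I | I \<in> {I. I \<subseteq> L \<and> card I = 2} \<and> (\<forall>l\<in>I. f l = j). fibre_moment J f (L - I))
      = real (card {I. I \<subseteq> ?F j \<and> card I = 2})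
        * (normal_moment (card (?F j) - 2) * (\<Prod>i\<in>J - {j}. normal_moment (card (?F i))))"
      unfolding set_eq by simp
    also have "card {I. I \<subseteq> ?F j \<and> card I = 2} = card (?F j) choose 2"
      using L by (intro n_subsets) auto
    also have "real (card (?F j) choose 2) * (normal_moment (card (?F j) - 2) * (\<Prod>i\<in>J - {j}. normal_moment (card (?F i))))
      = real (card (?F j)) / 2 * ?m"
      unfolding mult.assoc[symmetric] normal_moment_choose fibre_moment_def prod.remove[OF J j] ..
    finally show "(\<Sum>I | I \<in> {I. I \<subseteq> L \<and> card I = 2} \<and> (\<forall>l\<in>I. f l = j). fibre_moment J f (L - I))
      = real (card (?F j)) / 2 * ?m" .
  qed
  also have "\<dots> = (\<Sum>j\<in>J. real (card (?F j))) / 2 * ?m"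
    by (simp add: sum_distrib_right sum_divide_distrib)
  also have "(\<Sum>j\<in>J. real (card (?F j))) = real (card L)"
    using sum.group[OF L J f, of "\<lambda>_. 1 :: real"] by simp
  finally show ?thesis .
qed

definition gauss_form :: "nat set \<Rightarrow> (nat \<Rightarrow> complex) \<Rightarrow> (nat \<Rightarrow> real) \<Rightarrow> complex" where
  "gauss_form J a \<omega> = (\<Sum>j\<in>J. a j * of_real (\<omega> j))"

lemma prod_gauss_form:
  assumes "finite L" "finite J"
  shows "(\<Prod>l\<in>L. gauss_form J (A l) \<omega>) =
    (\<Sum>f\<in>L \<rightarrow>\<^sub>E J. (\<Prod>l\<in>L. A l (f l)) * of_real (\<Prod>l\<in>L. \<omega> (f l)))"
  using assms by (simp add: gauss_form_def prod_sum_PiE prod.distrib)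

lemma gauss_form_product:
  assumes L: "finite L" and J: "finite J"
  shows "integrable gauss_space (\<lambda>\<omega>. \<Prod>l\<in>L. gauss_form J (A l) \<omega>)"
    and "(\<integral>\<omega>. (\<Prod>l\<in>L. gauss_form J (A l) \<omega>) \<partial>gauss_space) =
      (\<Sum>f\<in>L \<rightarrow>\<^sub>E J. (\<Prod>l\<in>L. A l (f l)) * of_real (fibre_moment J f L))"
proof -
  have f: "f ` L \<subseteq> J" if "f \<in> L \<rightarrow>\<^sub>E J" for f using that by auto
  have 1: "integrable gauss_space (\<lambda>\<omega>. (\<Prod>l\<in>L. A l (f l)) * complex_of_real (\<Prod>l\<in>L. \<omega> (f l)))"
    if "f \<in> L \<rightarrow>\<^sub>E J" for f
    by (intro integrable_mult_right integrable_of_real gauss_space_moment(1)[OF L J f[OF that]])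
  show "integrable gauss_space (\<lambda>\<omega>. \<Prod>l\<in>L. gauss_form J (A l) \<omega>)"
    unfolding prod_gauss_form[OF L J] by (intro Bochner_Integration.integrable_sum 1)
  have "(\<integral>\<omega>. (\<Prod>l\<in>L. gauss_form J (A l) \<omega>) \<partial>gauss_space) =
      (\<Sum>f\<in>L \<rightarrow>\<^sub>E J. \<integral>\<omega>. (\<Prod>l\<in>L. A l (f l)) * complex_of_real (\<Prod>l\<in>L. \<omega> (f l)) \<partial>gauss_space)"
    unfolding prod_gauss_form[OF L J] by (rule Bochner_Integration.integral_sum) (rule 1)
  also have "\<dots> = (\<Sum>f\<in>L \<rightarrow>\<^sub>E J. (\<Prod>l\<in>L. A l (f l)) * of_real (fibre_moment J f L))"
  proof (rule sum.cong[OF refl])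
    fix g assume "g \<in> L \<rightarrow>\<^sub>E J"
    from gauss_space_moment(2)[OF L J f[OF this]]
    show "(\<integral>\<omega>. (\<Prod>l\<in>L. A l (g l)) * complex_of_real (\<Prod>l\<in>L. \<omega> (g l)) \<partial>gauss_space)
       = (\<Prod>l\<in>L. A l (g l)) * of_real (fibre_moment J g L)"
      by (simp del: of_real_prod)
  qed
  finally show "(\<integral>\<omega>. (\<Prod>l\<in>L. gauss_form J (A l) \<omega>) \<partial>gauss_space) =
      (\<Sum>f\<in>L \<rightarrow>\<^sub>E J. (\<Prod>l\<in>L. A l (f l)) * of_real (fibre_moment J f L))" .
qed

definition gauss_form_moment :: "nat set \<Rightarrow> (nat \<Rightarrow> nat \<Rightarrow> complex) \<Rightarrow> nat set \<Rightarrow> complex" where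
  "gauss_form_moment J A L = (\<integral>\<omega>. (\<Prod>l\<in>L. gauss_form J (A l) \<omega>) \<partial>gauss_space)"

text \<open>Expanding every linear form writes the product as a sum over the choices \<open>f\<close> of one coordinate for each
factor. To each \<open>f\<close> the formula for coordinates applies, and the choices made for the removed pair
recombine to its covariance.\<close>

lemma gauss_form_moment_rec:
  assumes L: "finite L" and J: "finite J"
  shows "(\<Sum>I | I \<subseteq> L \<and> card I = 2. (\<Sum>j\<in>J. \<Prod>l\<in>I. A l j) * gauss_form_moment J A (L - I))
     = of_nat (card L) / 2 * gauss_form_moment J A L"
proof -
  let ?T = "{I. I \<subseteq> L \<and> card I = 2}"
  let ?a = "\<lambda>f. \<Prod>l\<in>L. A l (f l)"
  have step: "(\<Sum>j\<in>J. \<Prod>l\<in>I. A l j) * gauss_form_moment J A (L - I) =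
     (\<Sum>f\<in>L \<rightarrow>\<^sub>E J. \<Sum>j | j \<in> J \<and> (\<forall>l\<in>I. f l = j). ?a f * of_real (fibre_moment J f (L - I)))"
    if I: "I \<in> ?T" for I
  proof -
    have LI: "I \<subseteq> L" using I by auto
    let ?b = "\<lambda>g. (\<Prod>l\<in>L - I. A l (g l)) * complex_of_real (fibre_moment J g (L - I))"
    have "(\<Sum>f\<in>L \<rightarrow>\<^sub>E J. \<Sum>j | j \<in> J \<and> (\<forall>l\<in>I. f l = j). ?a f * of_real (fibre_moment J f (L - I)))
      = (\<Sum>j\<in>J. \<Sum>f | f \<in> L \<rightarrow>\<^sub>E J \<and> (\<forall>l\<in>I. f l = j). ?a f * of_real (fibre_moment J f (L - I)))"
      by (rule sum.swap_restrict) (use L J in \<open>auto intro: finite_PiE\<close>)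
    also have "\<dots> = (\<Sum>j\<in>J. \<Sum>g\<in>(L - I) \<rightarrow>\<^sub>E J. (\<Prod>l\<in>I. A l j) * ?b g)"
    proof (rule sum.cong[OF refl])
      fix j assume j: "j \<in> J"
      show "(\<Sum>f | f \<in> L \<rightarrow>\<^sub>E J \<and> (\<forall>l\<in>I. f l = j). ?a f * of_real (fibre_moment J f (L - I)))
        = (\<Sum>g\<in>(L - I) \<rightarrow>\<^sub>E J. (\<Prod>l\<in>I. A l j) * ?b g)"
      proof (rule sum.reindex_bij_witness[where i = "\<lambda>g l. if l \<in> I then j else g l" and j = "\<lambda>f. restrict f (L - I)"])
        fix f assume f: "f \<in> {f. f \<in> L \<rightarrow>\<^sub>E J \<and> (\<forall>l\<in>I. f l = j)}"
        then have fE: "f \<in> L \<rightarrow>\<^sub>E J" and fI: "\<And>l. l \<in> I \<Longrightarrow> f l = j" by auto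
        show "(\<lambda>l. if l \<in> I then j else restrict f (L - I) l) = f"
          using fI LI PiE_arb[OF fE] by (auto simp: fun_eq_iff)
        show "restrict f (L - I) \<in> (L - I) \<rightarrow>\<^sub>E J" using fE by auto
        have "(\<Prod>l\<in>L. A l (f l)) = (\<Prod>l\<in>L - I. A l (f l)) * (\<Prod>l\<in>I. A l (f l))"
          by (rule prod.subset_diff[OF LI L])
        also have "(\<Prod>l\<in>I. A l (f l)) = (\<Prod>l\<in>I. A l j)" using fI by simp
        also have "(\<Prod>l\<in>L - I. A l (f l)) = (\<Prod>l\<in>L - I. A l (restrict f (L - I) l))" by simp
        finally show "(\<Prod>l\<in>I. A l j) * ?b (restrict f (L - I)) = ?a f * of_real (fibre_moment J f (L - I))"
          using fibre_moment_cong[of "L - I" f "restrict f (L - I)" J] by simp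
      next
        fix g assume g: "g \<in> (L - I) \<rightarrow>\<^sub>E J"
        show "restrict (\<lambda>l. if l \<in> I then j else g l) (L - I) = g"
          using PiE_arb[OF g] by (auto simp: fun_eq_iff)
        show "(\<lambda>l. if l \<in> I then j else g l) \<in> {f. f \<in> L \<rightarrow>\<^sub>E J \<and> (\<forall>l\<in>I. f l = j)}"
          using g j LI by (auto simp: PiE_iff extensional_def)
      qed
    qed
    also have "\<dots> = (\<Sum>j\<in>J. \<Prod>l\<in>I. A l j) * gauss_form_moment J A (L - I)"
      unfolding gauss_form_moment_def gauss_form_product(2)[OF finite_Diff[OF L] J] sum_product ..
    finally show ?thesis ..
  qed
  have "(\<Sum>I\<in>?T. (\<Sum>j\<in>J. \<Prod>l\<in>I. A l j) * gauss_form_moment J A (L - I)) =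
    (\<Sum>I\<in>?T. \<Sum>f\<in>L \<rightarrow>\<^sub>E J. \<Sum>j | j \<in> J \<and> (\<forall>l\<in>I. f l = j). ?a f * of_real (fibre_moment J f (L - I)))"
    by (rule sum.cong[OF refl step])
  also have "\<dots> = (\<Sum>f\<in>L \<rightarrow>\<^sub>E J. ?a f *
      of_real (\<Sum>I\<in>?T. \<Sum>j | j \<in> J \<and> (\<forall>l\<in>I. f l = j). fibre_moment J f (L - I)))"
    by (subst sum.swap) (simp add: sum_distrib_left mult_ac)
  also have "\<dots> = (\<Sum>f\<in>L \<rightarrow>\<^sub>E J. ?a f * of_real (real (card L) / 2 * fibre_moment J f L))"
  proof (rule sum.cong[OF refl])
    fix f assume "f \<in> L \<rightarrow>\<^sub>E J"
    then have "f ` L \<subseteq> J" by auto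
    from fibre_moment_pairs[OF L J this]
    show "?a f * of_real (\<Sum>I\<in>?T. \<Sum>j | j \<in> J \<and> (\<forall>l\<in>I. f l = j). fibre_moment J f (L - I)) =
      ?a f * of_real (real (card L) / 2 * fibre_moment J f L)" by (rule arg_cong)
  qed
  also have "\<dots> = of_nat (card L) / 2 * gauss_form_moment J A L"
    unfolding gauss_form_moment_def gauss_form_product(2)[OF L J] by (simp add: sum_distrib_left mult_ac)
  finally show ?thesis .
qed

lemma card_remove_pair: "finite L \<Longrightarrow> I \<subseteq> L \<Longrightarrow> card I = 2 \<Longrightarrow> card L = card (L - I) + 2"
  by (metis card_Diff_subset card_mono finite_subset le_add_diff_inverse2)

text \<open>Wick's formula: the recursion \<open>gauss_form_moment_rec\<close> gains a factor \<open>n\<close> whenever the number of factors is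
\<open>2 n\<close>, whence the factorial.\<close>

lemma pairsum_gauss_form_moment:
  assumes "finite J" "finite L" "card L = 2 * n"
  shows "pairsum (\<lambda>I. \<Sum>j\<in>J. \<Prod>l\<in>I. A l j) n L = fact n * gauss_form_moment J A L"
  using assms(2,3)
proof (induction n arbitrary: L)
  case 0
  then have "L = {}" by simp
  moreover have "gauss_form_moment J A {} = 1"
    using prob_space.prob_space[OF prob_space_gauss_space] by (simp add: gauss_form_moment_def)
  ultimately show ?case by simp
next
  case (Suc n)
  let ?c = "\<lambda>I. \<Sum>j\<in>J. \<Prod>l\<in>I. A l j"
  have "pairsum ?c n (L - I) = fact n * gauss_form_moment J A (L - I)" if "I \<subseteq> L" "card I = 2" for I
    using Suc.prems card_remove_pair[OF Suc.prems(1) that] by (intro Suc.IH) auto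
  then have "pairsum ?c (Suc n) L = fact n * (\<Sum>I | I \<subseteq> L \<and> card I = 2. ?c I * gauss_form_moment J A (L - I))"
    by (simp add: sum_distrib_left mult_ac)
  also have "\<dots> = fact (Suc n) * gauss_form_moment J A L"
    unfolding gauss_form_moment_rec[OF Suc.prems(1) assms(1)] using Suc.prems(2) by simp
  finally show ?case .
qed

lemma gauss_form_moment_odd:
  assumes "finite J" "finite L" "odd (card L)"
  shows "gauss_form_moment J A L = 0"
  using assms(2,3)
proof (induction "card L" arbitrary: L rule: less_induct)
  case less
  have "gauss_form_moment J A (L - I) = 0" if "I \<subseteq> L" "card I = 2" for I
    using less.prems card_remove_pair[OF less.prems(1) that] by (intro less.hyps) auto
  then have "of_nat (card L) / 2 * gauss_form_moment J A L = 0"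
    unfolding gauss_form_moment_rec[OF less.prems(1) assms(1), symmetric] by simp
  moreover have "card L \<noteq> 0" using less.prems(2) by (metis even_zero)
  ultimately show ?case by simp
qed

lemma gauss_form_measurable [measurable]: "gauss_form J a \<in> borel_measurable gauss_space"
  unfolding gauss_form_def gauss_space_def by measurable

lemma gauss_form_integrable_power:
  assumes J: "finite J"
  shows "integrable gauss_space (\<lambda>\<omega>. cmod (gauss_form J a \<omega>) ^ n)"
proof -
  have "integrable gauss_space (\<lambda>\<omega>. norm (\<Prod>l\<in>{..<n}. gauss_form J a \<omega>))"
    using gauss_form_product(1)[of "{..<n}" J "\<lambda>_. a"] J by (intro integrable_norm) simp
  then show ?thesis by (simp add: norm_power)
qed

text \<open>Let \<open>z\<close> be a standard complex Gaussian vector indexed by \<open>X\<close>, with \<open>E [z\<^sub>b z\<^sub>b] = 0\<close> and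
\<open>E [|z\<^sub>b|^2] = 1\<close>. Then the entries of \<open>(z + C cnj z) / sqrt 2\<close> satisfy
\<open>E [M\<^sub>x M\<^sub>y] = (C x y + C y x) / 2\<close>. The coefficients below are those of this vector with respect to the
real and imaginary parts of \<open>sqrt 2 z\<close>; the boolean distinguishes the two.\<close>

lemma symmetric_factorization:
  fixes C :: "'a::countable \<Rightarrow> 'a \<Rightarrow> complex"
  assumes X: "finite X" and sym: "\<And>x y. x \<in> X \<Longrightarrow> y \<in> X \<Longrightarrow> C x y = C y x"
  shows "\<exists>(J :: nat set) A. finite J \<and> (\<forall>x\<in>X. \<forall>y\<in>X. (\<Sum>j\<in>J. A x j * A y j) = C x y)"
proof -
  define d where "d x b = (if x = b then 1 else 0 :: complex)" for x b :: 'a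
  define a where "a x = (\<lambda>(b, e). if e then (d x b + C x b) / 2 else \<i> * (d x b - C x b) / 2)"
    for x
  let ?B = "X \<times> (UNIV :: bool set)"
  let ?J = "to_nat ` ?B"
  have inj: "inj_on (to_nat :: 'a \<times> bool \<Rightarrow> nat) ?B" by (rule inj_on_subset[OF inj_to_nat]) simp
  have "(\<Sum>j\<in>?J. a x (from_nat j) * a y (from_nat j)) = C x y" if xy: "x \<in> X" "y \<in> X" for x y
  proof -
    have "(\<Sum>j\<in>?J. a x (from_nat j) * a y (from_nat j)) = (\<Sum>b\<in>?B. a x b * a y b)"
      by (subst sum.reindex[OF inj]) simp
    also have "\<dots> = (\<Sum>b\<in>X. \<Sum>e\<in>UNIV. a x (b, e) * a y (b, e))"
      by (simp add: sum.cartesian_product)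
    also have "\<dots> = (\<Sum>b\<in>X. (d x b * C y b + C x b * d y b) / 2)"
    proof (rule sum.cong[OF refl])
      fix b assume "b \<in> X"
      have "(\<Sum>e\<in>UNIV. a x (b, e) * a y (b, e)) =
        (d x b + C x b) / 2 * ((d y b + C y b) / 2) + \<i> * (d x b - C x b) / 2 * (\<i> * (d y b - C y b) / 2)"
        by (simp add: a_def UNIV_bool)
      also have "\<dots> = (d x b * C y b + C x b * d y b) / 2"
        by (simp add: field_simps)
      finally show "(\<Sum>e\<in>UNIV. a x (b, e) * a y (b, e)) = (d x b * C y b + C x b * d y b) / 2" .
    qed
    also have "\<dots> = ((\<Sum>b\<in>X. d x b * C y b) + (\<Sum>b\<in>X. C x b * d y b)) / 2"
      by (simp only: sum_divide_distrib[symmetric] sum.distrib)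
    also have "\<dots> = (C y x + C x y) / 2"
      using X xy by (simp add: d_def if_distrib[of "\<lambda>t. t * _"] if_distrib[of "\<lambda>t. _ * t"] cong: if_cong)
    also have "\<dots> = C x y" using sym[OF xy] by simp
    finally show ?thesis .
  qed
  then show ?thesis using X by (intro exI[of _ ?J] exI[of _ "\<lambda>x j. a x (from_nat j)"]) auto
qed

section \<open>The covariance of the entries\<close>

lemma bij_betw_perm_act:
  assumes h: "bij_betw h S T"
  shows "bij_betw (perm_act h) {q. partition_on (S <+> S) q} {q. partition_on (T <+> T) q}"
proof -
  let ?k = "inv_into S h"
  have k: "bij_betw ?k T S" using h by (rule bij_betw_inv_into)
  have U: "\<Union>q \<subseteq> A" if "partition_on A q" for A :: "(nat + nat) set" and q
    using partition_onD1[OF that] by simp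
  have 1: "perm_act ?k (perm_act h q) = q" if q: "partition_on (S <+> S) q" for q
  proof -
    have "?k (h x) = id x" if "x \<in> S" for x using that h by (simp add: bij_betw_def)
    from perm_act_comp[of S ?k h id, OF this U[OF q]] perm_act_ident[of S id, OF _ U[OF q]]
    show ?thesis by simp
  qed
  have 2: "perm_act h (perm_act ?k q) = q" if q: "partition_on (T <+> T) q" for q
  proof -
    have "h (?k x) = id x" if "x \<in> T" for x using that h by (simp add: bij_betw_def f_inv_into_f)
    from perm_act_comp[of T h ?k id, OF this U[OF q]] perm_act_ident[of T id, OF _ U[OF q]]
    show ?thesis by simp
  qed
  show ?thesis
    by (rule bij_betw_byWitness[where f' = "perm_act ?k"])
       (use 1 2 perm_act_partition[OF _ h] perm_act_partition[OF _ k] in auto)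
qed

lemma id_join_ratio_perm_act:
  assumes h: "bij_betw h S T" and q: "partition_on (S <+> S) q"
  shows "id_join_ratio N T (perm_act h q) = id_join_ratio N S q"
proof -
  note b = bij_betw_map_sum_Plus[OF h]
  have U: "\<Union>q \<subseteq> S <+> S" using partition_onD1[OF q] by simp
  have "\<Union>(pair_blocks S) \<subseteq> S <+> S" by (auto simp: pair_blocks_def)
  then have U': "\<Union>(q \<union> pair_blocks S) \<subseteq> S <+> S" using U by simp
  have "T = h ` S" using h by (simp add: bij_betw_def)
  then have "pair_blocks T = (`) (map_sum h h) ` pair_blocks S"
    by (simp add: pair_blocks_def image_image)
  then have e: "perm_act h q \<union> pair_blocks T = (`) (map_sum h h) ` (q \<union> pair_blocks S)"
    by (simp add: perm_act_def image_Un)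
  show ?thesis
    unfolding id_join_ratio_def e card_block_maps_image[OF b U']
    unfolding perm_act_def card_block_maps_image[OF b U] ..
qed

lemma blockwise_constant_perm_act: "blockwise_constant (perm_act h q) i \<longleftrightarrow> blockwise_constant q (i \<circ> map_sum h h)"
  by (simp add: blockwise_constant_def perm_act_def)

lemma blockwise_constant_cong:
  assumes "\<Union>q \<subseteq> A" "\<And>x. x \<in> A \<Longrightarrow> i x = j x"
  shows "blockwise_constant q i \<longleftrightarrow> blockwise_constant q j"
proof -
  have "i a = j a" if "B \<in> q" "a \<in> B" for B a using assms that by blast
  then show ?thesis unfolding blockwise_constant_def by (metis (no_types, lifting))
qed

lemma pair_cov_cong:
  assumes "\<And>x. x \<in> I <+> I \<Longrightarrow> i x = j x"
  shows "pair_cov \<phi> N i I = pair_cov \<phi> N j I"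
  unfolding pair_cov_def
proof (rule sum.cong[OF refl])
  fix q assume "q \<in> {q. partition_on (I <+> I) q}"
  then have "\<Union>q \<subseteq> I <+> I" by (auto simp: partition_on_def)
  from blockwise_constant_cong[OF this assms]
  show "\<phi> (prestrict q I) * of_real (id_join_ratio N I q) * of_bool (blockwise_constant q i) =
    \<phi> (prestrict q I) * of_real (id_join_ratio N I q) * of_bool (blockwise_constant q j)" by simp
qed

text \<open>Relabelling is a bijection between partitions that respects the normalization and turns constancy of \<open>i\<close>
into constancy of the relabelled map.\<close>

lemma pair_cov_transport:
  assumes h: "bij_betw h S T"
    and \<phi>: "\<And>q. partition_on (S <+> S) q \<Longrightarrow> \<phi> (prestrict (perm_act h q) T) = \<phi> (prestrict q S)"
  shows "pair_cov \<phi> N i T = pair_cov \<phi> N (i \<circ> map_sum h h) S"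
proof -
  have "pair_cov \<phi> N i T = (\<Sum>q | partition_on (S <+> S) q.
     \<phi> (prestrict (perm_act h q) T) * of_real (id_join_ratio N T (perm_act h q)) * of_bool (blockwise_constant (perm_act h q) i))"
    unfolding pair_cov_def by (rule sum.reindex_bij_betw[OF bij_betw_perm_act[OF h], symmetric])
  also have "\<dots> = pair_cov \<phi> N (i \<circ> map_sum h h) S"
    unfolding pair_cov_def by (rule sum.cong[OF refl]) (simp add: \<phi> id_join_ratio_perm_act[OF h] blockwise_constant_perm_act)
  finally show ?thesis .
qed

text \<open>The positions \<open>x\<close> and \<open>y\<close> are pairs of a row and a column. Rows label the bottom points and columns the
top points, as in \<open>rho\<close>.\<close>

definition entry_cov :: "(diagram \<Rightarrow> complex) \<Rightarrow> nat \<Rightarrow> nat \<times> nat \<Rightarrow> nat \<times> nat \<Rightarrow> complex" where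
  "entry_cov \<phi> N x y = pair_cov \<phi> N
     (case_sum (\<lambda>l. if l = 1 then snd x else snd y) (\<lambda>l. if l = 1 then fst x else fst y)) {1..2}"

text \<open>This is where the invariance of the form under permutations enters: only a symmetric matrix can be
the matrix of the expectations \<open>E [M\<^sub>x M\<^sub>y]\<close>.\<close>

lemma entry_cov_sym:
  assumes "is_form 2 \<phi>"
  shows "entry_cov \<phi> N x y = entry_cov \<phi> N y x"
proof -
  \<comment> \<open>exchanging the two positions amounts to exchanging the labels 1 and 2\<close>
  let ?s = "Transposition.transpose (1::nat) 2"
  have s: "?s permutes {1..2}" by (rule permutes_swap_id) auto
  then have b: "bij_betw ?s {1..2} {1..2}" by (rule permutes_imp_bij)
  have "\<phi> (prestrict (perm_act ?s q) {1..2}) = \<phi> (prestrict q {1..2})"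
    if "partition_on ({1..2::nat} <+> {1..2}) q" for q
  proof -
    have q: "q \<in> Part 2" "perm_act ?s q \<in> Part 2"
      using that perm_act_partition[OF that b] by (simp_all add: Part_def points_def)
    show ?thesis unfolding q[THEN prestrict_full] using assms s q(1) by (simp add: is_form_def)
  qed
  note transport = pair_cov_transport[OF b this]
  let ?i = "\<lambda>x y. case_sum (\<lambda>l. if l = 1 then snd x else snd y) (\<lambda>l. if l = 1 then fst x else fst y)"
  have "entry_cov \<phi> N x y = pair_cov \<phi> N (?i x y \<circ> map_sum ?s ?s) {1..2}"
    unfolding entry_cov_def by (rule transport)
  also have "\<dots> = entry_cov \<phi> N y x"
    unfolding entry_cov_def
  proof (rule pair_cov_cong)
    fix z :: "nat + nat" assume "z \<in> {1..2} <+> {1..2}"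
    moreover have "l \<in> {1..2} \<Longrightarrow> l = 1 \<or> l = 2" for l :: nat by auto
    ultimately have "z = Inl 1 \<or> z = Inl 2 \<or> z = Inr 1 \<or> z = Inr 2" by (auto elim!: PlusE)
    then show "(?i x y \<circ> map_sum ?s ?s) z = ?i y x z" by (elim disjE) simp_all
  qed
  finally show ?thesis .
qed

text \<open>The ranks in \<open>{a, b}\<close> relabel \<open>a\<close> as 1 and \<open>b\<close> as 2, which is the relabelling built into
\<open>prestrict\<close>.\<close>

lemma pair_cov_eq_entry_cov:
  assumes ab: "a < b"
  shows "pair_cov \<phi> N i {a, b} = entry_cov \<phi> N (i (Inr a), i (Inl a)) (i (Inr b), i (Inl b))"
proof -
  let ?I = "{a, b}" and ?r = "rank_in {a, b}"
  have c: "card ?I = 2" using ab by simp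
  have r: "bij_betw ?r ?I {1..2}" using bij_betw_rank_in[of ?I] c by simp
  have "{j \<in> ?I. j \<le> a} = {a}" "{j \<in> ?I. j \<le> b} = {a, b}" using ab by auto
  then have rab: "?r a = 1" "?r b = 2" using ab by (simp_all add: rank_in_def)
  have "prestrict (perm_act ?r q) {1..2} = prestrict q ?I"
    if "partition_on (?I <+> ?I) q" for q
  proof -
    have "{1..2} = ?r ` ?I" using r by (simp add: bij_betw_def)
    moreover have "\<Union>q \<subseteq> ?I <+> ?I" using partition_onD1[OF that] by simp
    ultimately show ?thesis using prestrict_perm_act[of ?I q ?I] by simp
  qed
  then have transport: "pair_cov \<phi> N j {1..2} = pair_cov \<phi> N (j \<circ> map_sum ?r ?r) ?I" for j
    by (intro pair_cov_transport[OF r] arg_cong[where f = \<phi>])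
  show ?thesis
    unfolding entry_cov_def transport by (intro pair_cov_cong) (auto simp: rab)
qed


lemma pairsum_cong:
  assumes "\<And>I. I \<subseteq> L \<Longrightarrow> card I = 2 \<Longrightarrow> c I = c' I"
  shows "pairsum c n L = pairsum c' n L"
  using assms
proof (induction n arbitrary: L)
  case (Suc n)
  have "pairsum c n (L - I) = pairsum c' n (L - I)" if "I \<subseteq> L" for I
    by (rule Suc.IH) (use Suc.prems in blast)
  then show ?case using Suc.prems by (auto intro!: sum.cong)
qed simp

text \<open>For even \<open>k\<close> this combines Wick's formula with its expansion over partitions; the factorial is the one
in the exponential series. For odd \<open>k\<close> both sides vanish.\<close>

lemma expectation_entries:
  assumes J: "finite J"
    and cov: "\<And>x y. x \<in> X \<Longrightarrow> y \<in> X \<Longrightarrow> (\<Sum>j\<in>J. A x j * A y j) = entry_cov \<phi> N x y"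
    and i: "\<And>l. l \<in> {1..k} \<Longrightarrow> (i (Inr l), i (Inl l)) \<in> X"
  shows "(\<integral>\<omega>. (\<Prod>l = 1..k. gauss_form J (A (i (Inr l), i (Inl l))) \<omega>) \<partial>gauss_space) =
    (\<Sum>q\<in>Part k. boxexp (extend2 \<phi>) k q * of_real (id_join_ratio N {1..k} q) * of_bool (blockwise_constant q i))"
proof -
  let ?L = "{1..k}" and ?n = "k div 2"
  define B where "B l = A (i (Inr l), i (Inl l))" for l
  let ?c = "\<lambda>I. \<Sum>j\<in>J. \<Prod>l\<in>I. B l j"
  have c: "?c I = pair_cov \<phi> N i I" if I: "I \<subseteq> ?L" "card I = 2" for I
  proof -
    obtain a b where ab: "I = {a, b}" "a < b"
      using I(2) by (metis card_2_iff insert_commute linorder_neqE)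
    have "?c I = (\<Sum>j\<in>J. B a j * B b j)" using ab by simp
    also have "\<dots> = entry_cov \<phi> N (i (Inr a), i (Inl a)) (i (Inr b), i (Inl b))"
      unfolding B_def using I ab by (intro cov i) auto
    finally show ?thesis using pair_cov_eq_entry_cov[OF ab(2)] ab(1) by simp
  qed
  have P: "{q. partition_on (?L <+> ?L) q} = Part k" by (simp add: Part_def points_def)
  have "pairsum ?c ?n ?L = (\<Sum>q\<in>Part k. boxpower_on \<phi> ?n ?L q * of_real (id_join_ratio N ?L q) * of_bool (blockwise_constant q i))"
    unfolding P[symmetric]
    using pairsum_cong[of ?L ?c "pair_cov \<phi> N i", OF c] pairsum_expand[of ?L \<phi> N i ?n] by simp
  then have e: "pairsum ?c ?n ?L / fact ?n =
    (\<Sum>q\<in>Part k. boxexp (extend2 \<phi>) k q * of_real (id_join_ratio N ?L q) * of_bool (blockwise_constant q i))"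
    by (simp add: boxexp_eq_boxpower_on sum_divide_distrib)
  have "gauss_form_moment J B ?L = pairsum ?c ?n ?L / fact ?n"
  proof (cases "even k")
    case True
    then have "card ?L = 2 * ?n" by simp
    from pairsum_gauss_form_moment[OF J _ this, of B] show ?thesis by simp
  next
    case False
    then have "k \<noteq> 2 * ?n" by (metis dvd_triv_left)
    then have "card ?L \<noteq> 2 * ?n" unfolding card_atLeastAtMost diff_Suc_1 .
    then have "boxexp (extend2 \<phi>) k q = 0" if "q \<in> Part k" for q
      using that boxpower_on_eq_0[of ?L q ?n \<phi>] P by (auto simp: boxexp_eq_boxpower_on)
    then have "pairsum ?c ?n ?L / fact ?n = 0" unfolding e by simp
    moreover have "gauss_form_moment J B ?L = 0" using gauss_form_moment_odd[OF J, of ?L B] False by simp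
    ultimately show ?thesis by simp
  qed
  then show ?thesis using e by (simp add: gauss_form_moment_def B_def)
qed

section \<open>Traces against partitions\<close>

text \<open>A labelling \<open>i\<close> of the points determines one row and one column index of the tensor power, so the trace
collapses to a sum over labellings. Taking the trace of the product exchanges the roles of rows and
columns, and the transposition of \<open>p\<close> undoes this exchange.\<close>

lemma mat_trace_rho:
  "mat_trace (multi_indices k N) (mat_mult (multi_indices k N) (tensor k (\<lambda>_. M)) (rho N k (ptranspose p)))
    = (\<Sum>i\<in>block_maps (points k) {1..N} p. \<Prod>l = 1..k. M (i (Inr l)) (i (Inl l)))"
proof -
  let ?K = "multi_indices k N" and ?V = "block_maps (points k) {1..N}" and ?t = "case_sum Inr Inl :: nat + nat \<Rightarrow> nat + nat"
  define row where "row i = (\<lambda>l\<in>{1..k}. i (Inl l))" for i :: "nat + nat \<Rightarrow> nat"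
  define col where "col i = (\<lambda>l\<in>{1..k}. i (Inr l))" for i :: "nat + nat \<Rightarrow> nat"
  have finK: "finite ?K" by (simp add: multi_indices_def finite_PiE)
  have rho: "rho N k q c r = (\<Sum>i\<in>?V q. of_bool (c = col i \<and> r = row i))"
    if "c \<in> ?K" "r \<in> ?K" for q c r
  proof -
    have "tensor k (\<lambda>l. unit_mat (i (Inr l)) (i (Inl l))) c r = of_bool (c = col i \<and> r = row i)" for i
    proof -
      have "tensor k (\<lambda>l. unit_mat (i (Inr l)) (i (Inl l))) c r = (\<Prod>l = 1..k. of_bool (c l = i (Inr l) \<and> r l = i (Inl l)))"
        unfolding tensor_def unit_mat_def by (intro prod.cong) auto
      also have "\<dots> = of_bool (\<forall>l\<in>{1..k}. c l = i (Inr l) \<and> r l = i (Inl l))"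
        by (cases "\<forall>l\<in>{1..k}. c l = i (Inr l) \<and> r l = i (Inl l)") (auto intro!: prod_zero)
      also have "(\<forall>l\<in>{1..k}. c l = i (Inr l) \<and> r l = i (Inl l)) \<longleftrightarrow> c = col i \<and> r = row i"
      proof -
        have "c = col i \<longleftrightarrow> (\<forall>l\<in>{1..k}. c l = i (Inr l))" "r = row i \<longleftrightarrow> (\<forall>l\<in>{1..k}. r l = i (Inl l))"
          using that PiE_arb[of c "{1..k}"] PiE_arb[of r "{1..k}"]
          by (auto simp: col_def row_def multi_indices_def fun_eq_iff)
        then show ?thesis by blast
      qed
      finally show ?thesis .
    qed
    then show ?thesis by (simp add: rho_def block_maps_def)
  qed
  have rc: "row i \<in> ?K" "col i \<in> ?K" if "i \<in> ?V q" for i q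
    using block_maps_PiE[OF that] by (auto simp: row_def col_def multi_indices_def points_def PiE_iff)
  have "mat_trace ?K (mat_mult ?K (tensor k (\<lambda>_. M)) (rho N k (ptranspose p)))
    = (\<Sum>r\<in>?K. \<Sum>c\<in>?K. \<Sum>i\<in>?V (ptranspose p). (\<Prod>l = 1..k. M (r l) (c l)) * of_bool (c = col i \<and> r = row i))"
    unfolding mat_trace_def mat_mult_def tensor_def[of k "\<lambda>_. M"]
    by (intro sum.cong refl) (simp only: rho sum_distrib_left)
  also have "\<dots> = (\<Sum>i\<in>?V (ptranspose p). \<Sum>r\<in>?K. \<Sum>c\<in>?K. (\<Prod>l = 1..k. M (r l) (c l)) * of_bool (c = col i \<and> r = row i))"
    (is "_ = (\<Sum>i\<in>_. \<Sum>r\<in>_. \<Sum>c\<in>_. ?g i r c)")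
  proof -
    have "(\<Sum>r\<in>?K. \<Sum>c\<in>?K. \<Sum>i\<in>?V (ptranspose p). ?g i r c) = (\<Sum>r\<in>?K. \<Sum>i\<in>?V (ptranspose p). \<Sum>c\<in>?K. ?g i r c)"
      by (intro sum.cong refl sum.swap)
    also have "\<dots> = (\<Sum>i\<in>?V (ptranspose p). \<Sum>r\<in>?K. \<Sum>c\<in>?K. ?g i r c)" by (rule sum.swap)
    finally show ?thesis .
  qed
  also have "\<dots> = (\<Sum>i\<in>?V (ptranspose p). \<Prod>l = 1..k. M (i (Inl l)) (i (Inr l)))"
  proof (rule sum.cong[OF refl])
    fix i assume i: "i \<in> ?V (ptranspose p)"
    have "(\<Sum>r\<in>?K. \<Sum>c\<in>?K. (\<Prod>l = 1..k. M (r l) (c l)) * of_bool (c = col i \<and> r = row i))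
      = (\<Sum>r\<in>?K. if r = row i then (\<Sum>c\<in>?K. if c = col i then (\<Prod>l = 1..k. M (r l) (c l)) else 0) else 0)"
      by (intro sum.cong refl) (auto intro!: sum.cong sum.neutral)
    also have "\<dots> = (\<Prod>l = 1..k. M (row i l) (col i l))"
      using rc[OF i] finK by simp
    also have "\<dots> = (\<Prod>l = 1..k. M (i (Inl l)) (i (Inr l)))"
      by (intro prod.cong) (auto simp: row_def col_def)
    finally show "(\<Sum>r\<in>?K. \<Sum>c\<in>?K. (\<Prod>l = 1..k. M (r l) (c l)) * of_bool (c = col i \<and> r = row i))
      = (\<Prod>l = 1..k. M (i (Inl l)) (i (Inr l)))" .
  qed
  also have "\<dots> = (\<Sum>i\<in>?V p. \<Prod>l = 1..k. M (i (Inr l)) (i (Inl l)))"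
  proof (rule sum.reindex_bij_witness[where i = "\<lambda>i. i \<circ> ?t" and j = "\<lambda>i. i \<circ> ?t"])
    have tt: "?t (?t x) = x" for x by (cases x) auto
    have tp: "?t x \<in> points k \<longleftrightarrow> x \<in> points k" for x by (cases x) (auto simp: points_def)
    show "i \<circ> ?t \<circ> ?t = i" "i \<circ> ?t \<circ> ?t = i" for i :: "nat + nat \<Rightarrow> nat" by (simp_all add: fun_eq_iff tt)
    have inPiE: "i \<circ> ?t \<in> points k \<rightarrow>\<^sub>E {1..N}" if "i \<in> points k \<rightarrow>\<^sub>E {1..N}" for i
      using that by (auto simp: PiE_iff extensional_def tp)
    show "i \<circ> ?t \<in> ?V p" if i: "i \<in> ?V (ptranspose p)" for i
    proof (rule block_mapsI[OF inPiE[OF block_maps_PiE[OF i]]])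
      fix B a b assume "B \<in> p" "a \<in> B" "b \<in> B"
      then show "(i \<circ> ?t) a = (i \<circ> ?t) b"
        using block_maps_eq[OF i, of "?t ` B" "?t a" "?t b"] by (simp add: ptranspose_def)
    qed
    show "i \<circ> ?t \<in> ?V (ptranspose p)" if i: "i \<in> ?V p" for i
    proof (rule block_mapsI[OF inPiE[OF block_maps_PiE[OF i]]])
      fix B a b assume B: "B \<in> ptranspose p" "a \<in> B" "b \<in> B"
      then obtain B' where "B' \<in> p" "B = ?t ` B'" by (auto simp: ptranspose_def)
      then show "(i \<circ> ?t) a = (i \<circ> ?t) b"
        using B block_maps_eq[OF i, of B' "?t a" "?t b"] by (auto simp: tt)
    qed
  qed simp
  finally show ?thesis .
qed

section \<open>Convergence of the moments\<close>

lemma power_ratio_tendsto: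
  assumes "a \<le> b"
  shows "(\<lambda>N. complex_of_real (real N ^ a / real N ^ b)) \<longlonglongrightarrow> of_bool (a = b)"
proof (cases "a = b")
  case True
  have "eventually (\<lambda>N. complex_of_real (real N ^ a / real N ^ b) = 1) sequentially"
    using eventually_gt_at_top[of 0] by eventually_elim (simp add: True)
  then show ?thesis using True by (simp add: tendsto_eventually)
next
  case False
  then obtain d where d: "b = a + d" "d > 0" using assms by (metis le_iff_add add_0_right gr0I)
  have z: "(0::real) ^ d = 0" using d by simp
  have "(\<lambda>N. inverse (real N) ^ d) \<longlonglongrightarrow> 0"
    using tendsto_power[OF lim_inverse_n[where 'a = real], of d] unfolding z .
  moreover have "eventually (\<lambda>N. inverse (real N) ^ d = real N ^ a / real N ^ b) sequentially"
    using eventually_gt_at_top[of 0] by eventually_elim (simp add: d power_add field_simps)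
  ultimately have "(\<lambda>N. real N ^ a / real N ^ b) \<longlonglongrightarrow> 0" by (rule Lim_transform_eventually)
  then have "(\<lambda>N. complex_of_real (real N ^ a / real N ^ b)) \<longlonglongrightarrow> complex_of_real 0" by (rule tendsto_of_real)
  then show ?thesis using False by simp
qed

lemma id_join_ratio_points:
  assumes "q \<in> Part k"
  shows "id_join_ratio N {1..k} q = real N ^ nc (pjoin k q (id_part k)) / real N ^ nc q"
proof -
  have "pair_blocks {1..k} = id_part k" by (simp add: pair_blocks_def id_part_def)
  then show ?thesis
    using card_block_maps_join[OF assms id_part_in_Part, of "{1..N}"] card_block_maps_Part[OF assms, of "{1..N}"]
    by (simp add: id_join_ratio_def points_def)
qed

theorem theorem7p4:
  fixes \<phi> :: "diagram \<Rightarrow> complex"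
  assumes "is_form 2 \<phi>"
  shows "\<exists>(\<Omega> :: (nat \<Rightarrow> real) measure) M m.
           prob_space \<Omega> \<and>
           (\<forall>N. random_matrix \<Omega> N (M N)) \<and>
           converges_in_P_distribution \<Omega> M m \<and>
           P_Gaussian m \<and>
           has_R_transform m (boxexp (extend2 \<phi>))"
proof -
  let ?R = "boxexp (extend2 \<phi>)"
  define factors where "factors N J A \<longleftrightarrow> finite J \<and>
      (\<forall>x\<in>{1..N} \<times> {1..N}. \<forall>y\<in>{1..N} \<times> {1..N}. (\<Sum>j\<in>J. A x j * A y j) = entry_cov \<phi> N x y)"
    for N and J :: "nat set" and A
  have "\<exists>J A. factors N J A" for N
    unfolding factors_def by (rule symmetric_factorization) (auto intro: entry_cov_sym[OF assms])
  then obtain J A where F: "\<And>N. factors N (J N) (A N)" by metis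
  have J: "finite (J N)" for N using F[of N] by (simp add: factors_def)
  have A: "(\<Sum>j\<in>J N. A N x j * A N y j) = entry_cov \<phi> N x y"
    if "x \<in> {1..N} \<times> {1..N}" "y \<in> {1..N} \<times> {1..N}" for N x y
    using F[of N] that unfolding factors_def by blast
  define M where "M N \<omega> r c = gauss_form (J N) (A N (r, c)) \<omega>" for N \<omega> r c
  define m where "m k p = (\<Sum>q | q \<in> Part k \<and> ple k q p. ?R k q)" for k p
  have finP: "finite (Part k)" for k
    using finite_partitions[of "{1..k}"] by (simp add: Part_def points_def)
  have rm: "random_matrix gauss_space N (M N)" for N
    unfolding random_matrix_def M_def using gauss_form_integrable_power[OF J] by auto
  have moment: "E_moment gauss_space N (M N) k p =
      (\<Sum>q\<in>Part k. ?R k q * of_real (real N ^ (nc (pjoin k q (id_part k)) + nc (pjoin k q p))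
        / real N ^ (nc q + nc (pjoin k p (id_part k)))))" if p: "p \<in> Part k" for N k p
  proof -
    let ?V = "block_maps (points k) {1..N}"
    let ?X = "{1..N} \<times> {1..N}"
    have i: "(i (Inr l), i (Inl l)) \<in> ?X" if "i \<in> ?V p" "l \<in> {1..k}" for i l
    proof -
      have "Inr l \<in> points k" "Inl l \<in> points k" using that(2) by (auto simp: points_def)
      then show ?thesis using PiE_mem[OF block_maps_PiE[OF that(1)]] by blast
    qed
    have V: "(\<Sum>i\<in>?V p. of_bool (blockwise_constant q i)) = (of_nat (card (?V (q \<union> p))) :: complex)" for q
    proof -
      have "?V (q \<union> p) = ?V p \<inter> Collect (blockwise_constant q)"
      proof -
        have "?V q = {f \<in> points k \<rightarrow>\<^sub>E {1..N}. blockwise_constant q f}"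
          by (simp only: block_maps_def blockwise_constant_def)
        then show ?thesis unfolding block_maps_Un using block_maps_PiE by blast
      qed
      then show ?thesis by (simp add: sum_of_bool_eq)
    qed
    have "(\<integral>\<omega>. mat_trace (multi_indices k N)
        (mat_mult (multi_indices k N) (tensor k (\<lambda>_. M N \<omega>)) (rho N k (ptranspose p))) \<partial>gauss_space)
      = (\<Sum>i\<in>?V p. \<integral>\<omega>. (\<Prod>l = 1..k. gauss_form (J N) (A N (i (Inr l), i (Inl l))) \<omega>) \<partial>gauss_space)"
      unfolding mat_trace_rho M_def
      by (intro Bochner_Integration.integral_sum gauss_form_product(1)[OF _ J]) simp
    also have "\<dots> = (\<Sum>i\<in>?V p. \<Sum>q\<in>Part k. ?R k q * of_real (id_join_ratio N {1..k} q) * of_bool (blockwise_constant q i))"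
      by (intro sum.cong refl expectation_entries[OF J, where X = ?X] A i)
    also have "\<dots> = (\<Sum>q\<in>Part k. ?R k q * of_real (id_join_ratio N {1..k} q) * of_nat (card (?V (q \<union> p))))"
      by (subst sum.swap) (simp only: sum_distrib_left[symmetric] V)
    also have "\<dots> = (\<Sum>q\<in>Part k. ?R k q * of_real (real N ^ nc (pjoin k q (id_part k)) / real N ^ nc q)
         * of_real (real N ^ nc (pjoin k q p)))"
    proof (rule sum.cong[OF refl])
      fix q assume q: "q \<in> Part k"
      show "?R k q * of_real (id_join_ratio N {1..k} q) * of_nat (card (?V (q \<union> p))) =
        ?R k q * of_real (real N ^ nc (pjoin k q (id_part k)) / real N ^ nc q) * of_real (real N ^ nc (pjoin k q p))"
        unfolding id_join_ratio_points[OF q] card_block_maps_join[OF q p] by simp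
    qed
    finally show ?thesis
      unfolding E_moment_def by (simp add: sum_distrib_left power_add mult_ac)
  qed
  have conv: "converges_in_P_distribution gauss_space M m"
    unfolding converges_in_P_distribution_def
  proof (intro allI ballI)
    fix k p assume p: "p \<in> Part k"
    have "m k p = (\<Sum>q\<in>Part k. ?R k q * of_bool (nc (pjoin k q (id_part k)) + nc (pjoin k q p)
        = nc q + nc (pjoin k p (id_part k))))"
      unfolding m_def ple_iff sum.inter_filter[OF finP] by (rule sum.cong) auto
    then show "(\<lambda>N. E_moment gauss_space N (M N) k p) \<longlonglongrightarrow> m k p"
      unfolding moment[OF p]
      by (simp only:) (intro tendsto_sum tendsto_mult tendsto_const power_ratio_tendsto nc_pjoin_triangle p)
  qed
  have R: "has_R_transform m ?R" by (simp add: has_R_transform_def m_def)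
  \<comment> \<open>the exponential only uses the values of \<open>\<phi>\<close> on \<open>Part 2\<close>, which it reproduces there\<close>
  moreover have "?R k p = boxexp (extend2 (?R 2)) k p" if "p \<in> Part k" for k p
    using that boxexp_2 by (intro boxexp_cong) auto
  ultimately have "P_Gaussian m" unfolding P_Gaussian_def by blast
  then show ?thesis using prob_space_gauss_space rm conv R by blast
qed

end
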